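(* The $28$ bitangents to the Komiya--Kuribayashi quartic curve intersect along $324$ double and $9$ quadruple points (and at no other points).
   Context: Work over $\mathbb{C}$. The Komiya--Kuribayashi quartic is the smooth plane curve in $\mathbb{P}^2_{\mathbb{C}}$ given by $x^4 + y^4 + z^4 + 3(x^2y^2 + x^2z^2 + y^2z^2)=0$. A bitangent of a smooth plane quartic is a line tangent to the curve at two points, which are allowed to coincide, i.e. the line cuts out a divisor $2P+2P'$ on the curve, with $P=P'$ allowed. A double (respectively quadruple) point of a line arrangement is a point lying on exactly two (respectively exactly four) of the lines. *)

theory Defs
  imports
    "HOL-Analysis.Analysis"
    "HOL-Computational_Algebra.Polynomial"
    "HOL-Library.Multiset"
begin

section \<open>The complex projective plane\<close>

text \<open>
  Points and lines are the linear subspaces of \<open>complex ^ 3\<close> of dimension one and two;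
  incidence is inclusion. The prefix \<open>vec\<close> refers to linear algebra over \<open>complex\<close>,
  as opposed to the real vector space structure.
\<close>

definition proj_points :: "(complex ^ 3) set set" where
  "proj_points = {P. vec.subspace P \<and> vec.dim P = 1}"

definition proj_lines :: "(complex ^ 3) set set" where
  "proj_lines = {L. vec.subspace L \<and> vec.dim L = 2}"

section \<open>Bitangents\<close>

text \<open>
  \<open>line_cuts F L D\<close>: the line \<open>L\<close> is not contained in the curve \<open>F = 0\<close> and cuts out on it
  the effective divisor \<open>D\<close>, written as a multiset of points. For a ternary form \<open>F\<close>, the
  intersection multiplicity at the point spanned by \<open>p\<close> is the order of vanishing at \<open>t = 0\<close>
  of the restriction of \<open>F\<close> to the affine parametrisation \<open>t \<mapsto> p + t q\<close> of \<open>L\<close>, for any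
  \<open>q\<close> which together with \<open>p\<close> spans \<open>L\<close>. As \<open>p\<close> ranges over all nonzero vectors of \<open>L\<close>,
  this prescribes the multiplicity at every point of \<open>L\<close>.
\<close>

definition line_cuts ::
  "(complex ^ 3 \<Rightarrow> complex) \<Rightarrow> (complex ^ 3) set \<Rightarrow> (complex ^ 3) set multiset \<Rightarrow> bool" where
  "line_cuts F L D \<longleftrightarrow>
     L \<in> proj_lines \<and>
     (\<forall>P \<in># D. P \<in> proj_points \<and> P \<subseteq> L) \<and>
     (\<forall>p q. vec.span {p, q} = L \<longrightarrow>
        (\<exists>r :: complex poly. r \<noteq> 0 \<and> (\<forall>t. poly r t = F (p + t *s q)) \<and>
           order 0 r = count D (vec.span {p})))"

definition bitangents :: "(complex ^ 3 \<Rightarrow> complex) \<Rightarrow> (complex ^ 3) set set" where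
  "bitangents F = {L. \<exists>P P'. line_cuts F L {#P, P, P', P'#}}"

definition komiya_kuribayashi :: "complex ^ 3 \<Rightarrow> complex" where
  "komiya_kuribayashi v =
     (let x = v $ 1; y = v $ 2; z = v $ 3 in
       x ^ 4 + y ^ 4 + z ^ 4 + 3 * (x ^ 2 * y ^ 2 + x ^ 2 * z ^ 2 + y ^ 2 * z ^ 2))"

section \<open>Line arrangements\<close>

definition lines_through :: "(complex ^ 3) set set \<Rightarrow> (complex ^ 3) set \<Rightarrow> (complex ^ 3) set set" where
  "lines_through A P = {L \<in> A. P \<subseteq> L}"

definition intersection_points :: "(complex ^ 3) set set \<Rightarrow> (complex ^ 3) set set" where
  "intersection_points A =
     {P \<in> proj_points. \<exists>L \<in> A. \<exists>M \<in> A. L \<noteq> M \<and> P \<subseteq> L \<and> P \<subseteq> M}"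

text \<open>
  The points on exactly \<open>k\<close> lines. Only \<open>k > 0\<close> is meaningful, since \<open>card\<close> of an infinite
  set is zero.
\<close>

definition k_fold_points :: "nat \<Rightarrow> (complex ^ 3) set set \<Rightarrow> (complex ^ 3) set set" where
  "k_fold_points k A = {P \<in> proj_points. card (lines_through A P) = k}"

abbreviation double_points :: "(complex ^ 3) set set \<Rightarrow> (complex ^ 3) set set" where
  "double_points \<equiv> k_fold_points 2"

abbreviation quadruple_points :: "(complex ^ 3) set set \<Rightarrow> (complex ^ 3) set set" where
  "quadruple_points \<equiv> k_fold_points 4"

end

theory Submission
  imports Defs
begin

text \<open>
  A line is a bitangent of a plane quartic \<open>F = 0\<close> iff the restriction of \<open>F\<close> to it is the square
  of a nonzero binary quadratic form. On the line \<open>z = a x + b y\<close>, with \<open>A = a\<^sup>2\<close> and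
  \<open>B = b\<^sup>2\<close>, comparing the coefficients of the restriction with those of a square forces \<open>a = 0\<close>,
  \<open>b = 0\<close>, \<open>A = B\<close> or \<open>A + B = -3\<close>, and each case leaves finitely many lines. Up to scaling, all 28
  bitangents have coefficients in \<open>\<int>[\<i>, \<surd>5]\<close>, so that three of them can be shown not to be
  concurrent by reducing their determinant modulo a suitable prime. The triples whose determinant
  vanishes fall into nine sets of four concurrent lines; any two of these sets share at most one
  line. Hence every point on more than two bitangents is on exactly four, and the double points
  correspond to the \<open>28 \<cdot> 27 / 2 - 9 \<cdot> 6 = 324\<close> remaining pairs of lines.
\<close>

section \<open>Points and lines of the projective plane\<close>

text \<open>If the restriction has coefficients c0, ..., c4 and is the square of a binary quadratic
  form, then c1^2 c4 = c3^2 c0. On \<open>z = a x + b y\<close> the difference of the two sides is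
  20 a^2 b^2 (B - A) (A + B + 3), which is where the cases come from. Lines through (0, 0, 1) have
  no such equation; they are \<open>y = a x\<close> and \<open>x = 0\<close> and are treated
  separately. The obstacle in the second half is the exact evaluation of 3276 complex determinants.
  Reduction modulo a prime needs one implication only: a determinant that is zero stays zero, so a
  nonzero residue excludes concurrency. That the nine sets really are concurrent is certified
  independently, by explicit points. The same computation shows that the 28 lines are distinct: two
  equal lines would be concurrent with every third line.\<close>

definition cross :: "complex ^ 3 \<Rightarrow> complex ^ 3 \<Rightarrow> complex \<times> complex \<times> complex" where
  "cross p q = (p $ 2 * q $ 3 - p $ 3 * q $ 2, p $ 3 * q $ 1 - p $ 1 * q $ 3, p $ 1 * q $ 2 - p $ 2 * q $ 1)"

text \<open>Line coordinates are plain triples, so that \<open>kk_coeffs\<close> and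
  \<open>det3\<close> can be stated over any commutative ring and also evaluated over the
  integers.\<close>

fun line_of :: "complex \<times> complex \<times> complex \<Rightarrow> (complex ^ 3) set" where
  "line_of (a, b, c) = {v. a * v $ 1 + b * v $ 2 + c * v $ 3 = 0}"

lemma span_pair: "vec.span {p, q} = {s *s p + t *s q | s t. True}"
  for p q :: "complex ^ 3"
proof -
  have "x \<in> vec.span {p, q} \<longleftrightarrow> (\<exists>s t. x = s *s p + t *s q)" for x
    unfolding vec.span_breakdown_eq vec.span_singleton
    by (auto simp: algebra_simps image_iff)
  then show ?thesis by auto
qed

text \<open>Cramer's rule: a nonzero component of the cross product is an invertible 2 x 2 minor,
  through which two coordinates of \<open>v\<close> are expressed exactly by \<open>p\<close> and
  \<open>q\<close>.\<close>

lemma span_cross: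
  assumes "cross p q \<noteq> (0, 0, 0)"
  shows "vec.span {p, q} = line_of (cross p q)"
proof (intro equalityI subsetI)
  fix v assume "v \<in> vec.span {p, q}"
  then obtain s t where "v = s *s p + t *s q" by (auto simp: span_pair)
  then show "v \<in> line_of (cross p q)"
    by (simp add: cross_def algebra_simps)
next
  fix v assume "v \<in> line_of (cross p q)"
  \<comment> \<open>The determinant of \<open>v\<close>, \<open>p\<close>, \<open>q\<close>: the
    defect in the one coordinate that the chosen minor does not control.\<close>
  define e where "e = (p $ 2 * q $ 3 - p $ 3 * q $ 2) * v $ 1 + (p $ 3 * q $ 1 - p $ 1 * q $ 3) * v $ 2 +
     (p $ 1 * q $ 2 - p $ 2 * q $ 1) * v $ 3"
  have "e = 0" using \<open>v \<in> line_of (cross p q)\<close> by (simp add: cross_def e_def)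
  have wit: "v \<in> vec.span {p, q}" if "d \<noteq> 0" "d *s v = s *s p + t *s q" for d s t
  proof -
    have "v = (s/d) *s p + (t/d) *s q"
      using that by (simp add: vec_eq_iff field_simps)
    then show ?thesis by (auto simp: span_pair)
  qed
  from assms consider "p $ 2 * q $ 3 - p $ 3 * q $ 2 \<noteq> 0" | "p $ 3 * q $ 1 - p $ 1 * q $ 3 \<noteq> 0"
    | "p $ 1 * q $ 2 - p $ 2 * q $ 1 \<noteq> 0" by (auto simp: cross_def)
  then show "v \<in> vec.span {p, q}"
  proof cases
    case 1
    have
      "(p $ 2 * q $ 3 - p $ 3 * q $ 2) * v $ 1 = (v $ 2 * q $ 3 - v $ 3 * q $ 2) * p $ 1 + (p $ 2 * v $ 3 - p $ 3 * v $ 2) * q $ 1 + e"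
      "(p $ 2 * q $ 3 - p $ 3 * q $ 2) * v $ 2 = (v $ 2 * q $ 3 - v $ 3 * q $ 2) * p $ 2 + (p $ 2 * v $ 3 - p $ 3 * v $ 2) * q $ 2"
      "(p $ 2 * q $ 3 - p $ 3 * q $ 2) * v $ 3 = (v $ 2 * q $ 3 - v $ 3 * q $ 2) * p $ 3 + (p $ 2 * v $ 3 - p $ 3 * v $ 2) * q $ 3"
      by (simp_all add: e_def algebra_simps)
    then show ?thesis by (intro wit[OF 1, of "v $ 2 * q $ 3 - v $ 3 * q $ 2"
          "p $ 2 * v $ 3 - p $ 3 * v $ 2"]) (simp add: vec_eq_iff forall_3 algebra_simps \<open>e = 0\<close>)
  next
    case 2
    have
      "(p $ 3 * q $ 1 - p $ 1 * q $ 3) * v $ 1 = (v $ 3 * q $ 1 - v $ 1 * q $ 3) * p $ 1 + (p $ 3 * v $ 1 - p $ 1 * v $ 3) * q $ 1"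
      "(p $ 3 * q $ 1 - p $ 1 * q $ 3) * v $ 2 = (v $ 3 * q $ 1 - v $ 1 * q $ 3) * p $ 2 + (p $ 3 * v $ 1 - p $ 1 * v $ 3) * q $ 2 + e"
      "(p $ 3 * q $ 1 - p $ 1 * q $ 3) * v $ 3 = (v $ 3 * q $ 1 - v $ 1 * q $ 3) * p $ 3 + (p $ 3 * v $ 1 - p $ 1 * v $ 3) * q $ 3"
      by (simp_all add: e_def algebra_simps)
    then show ?thesis by (intro wit[OF 2, of "v $ 3 * q $ 1 - v $ 1 * q $ 3"
          "p $ 3 * v $ 1 - p $ 1 * v $ 3"]) (simp add: vec_eq_iff forall_3 algebra_simps \<open>e = 0\<close>)
  next
    case 3
    have
      "(p $ 1 * q $ 2 - p $ 2 * q $ 1) * v $ 1 = (v $ 1 * q $ 2 - v $ 2 * q $ 1) * p $ 1 + (p $ 1 * v $ 2 - p $ 2 * v $ 1) * q $ 1"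
      "(p $ 1 * q $ 2 - p $ 2 * q $ 1) * v $ 2 = (v $ 1 * q $ 2 - v $ 2 * q $ 1) * p $ 2 + (p $ 1 * v $ 2 - p $ 2 * v $ 1) * q $ 2"
      "(p $ 1 * q $ 2 - p $ 2 * q $ 1) * v $ 3 = (v $ 1 * q $ 2 - v $ 2 * q $ 1) * p $ 3 + (p $ 1 * v $ 2 - p $ 2 * v $ 1) * q $ 3 + e"
      by (simp_all add: e_def algebra_simps)
    then show ?thesis by (intro wit[OF 3, of "v $ 1 * q $ 2 - v $ 2 * q $ 1"
          "p $ 1 * v $ 2 - p $ 2 * v $ 1"]) (simp add: vec_eq_iff forall_3 algebra_simps \<open>e = 0\<close>)
  qed
qed

lemma independent_pair:
  assumes "cross p q \<noteq> (0, 0, 0)"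
  shows "vec.independent {p, q}" "p \<noteq> q"
proof -
  show "p \<noteq> q" using assms by (auto simp: cross_def)
  have "q \<noteq> 0" using assms by (auto simp: cross_def)
  moreover have "p \<notin> vec.span {q}" using assms
    by (auto simp: vec.span_singleton cross_def)
  ultimately show "vec.independent {p, q}"
    using \<open>p \<noteq> q\<close> by (simp add: vec.independent_insert)
qed

lemma span_pair_line:
  assumes "cross p q \<noteq> (0, 0, 0)"
  shows "vec.span {p, q} \<in> proj_lines"
  using independent_pair[OF assms] by (simp add: proj_lines_def vec.dim_eq_card_independent)

lemma cross_eq_0_dim:
  assumes "cross p q = (0, 0, 0)"
  shows "vec.dim (vec.span {p, q}) \<le> 1"
proof (cases "p = 0")
  case True
  then show ?thesis using vec.dim_le_card'[of "{q}"] by simp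
next
  case False
  then obtain i where i: "p $ i \<noteq> 0" by (auto simp: vec_eq_iff)
  have "\<forall>j. p $ i * q $ j = q $ i * p $ j"
    using assms i exhaust_3[of i] unfolding forall_3 cross_def by (auto simp: mult.commute)
  then have "q = (q $ i / p $ i) *s p" using i by (auto simp: vec_eq_iff field_simps)
  then have "q \<in> vec.span {p}" by (metis vec.span_base vec.span_scale singletonI)
  then have "vec.span {p, q} = vec.span {p}" using vec.span_redundant[of q "{p}"] by (simp add: insert_commute)
  then show ?thesis using vec.dim_le_card'[of "{p}"] by simp
qed

lemma proj_line_span_iff:
  "vec.span {p, q} \<in> proj_lines \<longleftrightarrow> cross p q \<noteq> (0, 0, 0)"
  using cross_eq_0_dim[of p q] span_pair_line[of p q] by (auto simp: proj_lines_def)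

lemma proj_lineE:
  assumes "L \<in> proj_lines"
  obtains p q where "L = vec.span {p, q}" "cross p q \<noteq> (0, 0, 0)"
proof -
  obtain B where B: "B \<subseteq> L" "vec.independent B" "L \<subseteq> vec.span B" "card B = vec.dim L"
    using vec.basis_exists[of L] by metis
  moreover from B assms obtain p q where "B = {p, q}" by (auto simp: proj_lines_def card_2_iff)
  moreover have "vec.span B = L" using B assms
    by (intro vec.span_subspace) (auto simp: proj_lines_def)
  ultimately show ?thesis using that[of p q] assms proj_line_span_iff by metis
qed

lemma proj_pointE:
  assumes "P \<in> proj_points"
  obtains p where "P = vec.span {p}" "p \<noteq> 0"
proof -
  obtain B where B: "B \<subseteq> P" "vec.independent B" "P \<subseteq> vec.span B" "card B = vec.dim P"
    using vec.basis_exists[of P] by metis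
  moreover from B assms obtain p where "B = {p}" by (auto simp: proj_points_def card_1_singleton_iff)
  moreover have "vec.span B = P" using B assms
    by (intro vec.span_subspace) (auto simp: proj_points_def)
  moreover have "p \<noteq> 0" using B \<open>B = {p}\<close> by auto
  ultimately show ?thesis using that[of p] by metis
qed

lemma span_point: "p \<noteq> 0 \<Longrightarrow> vec.span {p} \<in> proj_points"
  by (simp add: proj_points_def vec.dim_span_eq_card_independent)

lemma point_eq_span:
  assumes "P \<in> proj_points" "p \<in> P" "p \<noteq> 0"
  shows "vec.span {p} = P"
proof (rule vec.subspace_dim_equal)
  show "vec.span {p} \<subseteq> P"
    using assms by (intro vec.span_minimal) (simp_all add: proj_points_def)
  show "vec.dim P \<le> vec.dim (vec.span {p})"
    using assms(1) span_point[OF assms(3)] by (simp only: proj_points_def mem_Collect_eq)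
qed (use assms in \<open>simp_all add: proj_points_def\<close>)

lemma line_of_scale:
  assumes "d \<noteq> 0"
  shows "line_of (d * a, d * b, d * c) = line_of (a, b, c)"
proof -
  have "d * a * v $ 1 + d * b * v $ 2 + d * c * v $ 3 = d * (a * v $ 1 + b * v $ 2 + c * v $ 3)"
    for v :: "complex ^ 3"
    by (simp add: algebra_simps)
  then show ?thesis using assms by simp
qed

lemma line_of_proj_line:
  assumes "l \<noteq> (0, 0, 0)"
  shows "line_of l \<in> proj_lines"
proof -
  obtain a b c where l: "l = (a, b, c)" by (cases l)
  have *: "line_of l \<in> proj_lines" if "cross p q = (d * a, d * b, d * c)" "d \<noteq> 0" for p q d
  proof -
    have "line_of (d * a, d * b, d * c) = line_of l" unfolding l by (rule line_of_scale) (rule that(2))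
    then show ?thesis using span_cross[of p q] span_pair_line[of p q] that assms l by auto
  qed
  \<comment> \<open>The witnesses below all lie on the line. The cross product of two of them is
    \<open>(a, b, c)\<close> times one of its entries, so the pair is chosen by which entry is
    nonzero.\<close>
  consider "a \<noteq> 0" | "b \<noteq> 0" | "c \<noteq> 0" using assms l by auto
  then show ?thesis
  proof cases
    case 1
    show ?thesis by (rule *[of "vector [b, -a, 0]" "vector [c, 0, -a]" a]) (use 1 in \<open>auto simp: cross_def\<close>)
  next
    case 2
    show ?thesis by (rule *[of "vector [b, -a, 0]" "vector [0, c, -b]" "b"]) (use 2 in \<open>auto simp: cross_def\<close>)
  next
    case 3
    show ?thesis by (rule *[of "vector [c, 0, -a]" "vector [0, c, -b]" "c"]) (use 3 in \<open>auto simp: cross_def\<close>)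
  qed
qed

text \<open>The adjugate of the coefficient matrix combines the three line equations into
  determinant times \<open>v\<close> equals zero.\<close>

lemma det_eq_0_of_common_point:
  assumes "v \<noteq> 0" "v \<in> line_of (a, b, c)" "v \<in> line_of (d, e, f)" "v \<in> line_of (g, h, i)"
  shows "a * (e * i - f * h) - b * (d * i - f * g) + c * (d * h - e * g) = 0" (is "?D = 0")
proof -
  define r where "r = a * v $ 1 + b * v $ 2 + c * v $ 3"
  define s where "s = d * v $ 1 + e * v $ 2 + f * v $ 3"
  define t where "t = g * v $ 1 + h * v $ 2 + i * v $ 3"
  have "r = 0" "s = 0" "t = 0" using assms by (simp_all add: r_def s_def t_def)
  moreover have
    "?D * v $ 1 = (e * i - f * h) * r - (b * i - c * h) * s + (b * f - c * e) * t"
    "?D * v $ 2 = - (d * i - f * g) * r + (a * i - c * g) * s - (a * f - c * d) * t"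
    "?D * v $ 3 = (d * h - e * g) * r - (a * h - b * g) * s + (a * e - b * d) * t"
    unfolding r_def s_def t_def by algebra+
  ultimately have "?D * v $ 1 = 0" "?D * v $ 2 = 0" "?D * v $ 3 = 0" by simp_all
  then show ?thesis using assms(1) by (auto simp: vec_eq_iff forall_3)
qed

lemma proj_lines_inter:
  assumes L: "L \<in> proj_lines" and M: "M \<in> proj_lines" and "L \<noteq> M"
  shows "L \<inter> M \<in> proj_points"
proof -
  have sub: "vec.subspace L" "vec.subspace M" "vec.dim L = 2" "vec.dim M = 2"
    using L M by (auto simp: proj_lines_def)
  have "vec.dim {x + y |x y. x \<in> L \<and> y \<in> M} + vec.dim (L \<inter> M) = 4"
    using vec.dim_sums_Int[OF sub(1,2)] sub by simp
  moreover have "vec.dim {x + y |x y. x \<in> L \<and> y \<in> M} \<le> 3"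
    using dim_subset_UNIV_cart_gen[of "{x + y |x y. x \<in> L \<and> y \<in> M}"] by simp
  moreover have "\<not> vec.dim (L \<inter> M) \<ge> 2"
  proof
    assume "vec.dim (L \<inter> M) \<ge> 2"
    then have "L \<inter> M = L" "L \<inter> M = M"
      using sub by (simp_all add: vec.subspace_dim_equal vec.subspace_inter)
    with \<open>L \<noteq> M\<close> show False by blast
  qed
  ultimately have "vec.dim (L \<inter> M) = 1" by linarith
  with sub show ?thesis by (auto simp: proj_points_def vec.subspace_inter)
qed

lemma proj_point_eq_inter:
  assumes "L \<in> proj_lines" "M \<in> proj_lines" "L \<noteq> M" "P \<in> proj_points" "P \<subseteq> L" "P \<subseteq> M"
  shows "P = L \<inter> M"
  using proj_lines_inter[OF assms(1-3)] assms(4-6)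
  by (intro vec.subspace_dim_equal) (auto simp: proj_points_def)

text \<open>The case \<open>L = M\<close> matters: the lemma is applied to bitangents before they
  are known to be distinct.\<close>

lemma proj_lines_common_point:
  assumes L: "L \<in> proj_lines" and M: "M \<in> proj_lines"
  shows "\<exists>P\<in>proj_points. P \<subseteq> L \<and> P \<subseteq> M"
proof (cases "L = M")
  case True
  obtain p q where pq: "L = vec.span {p, q}" "cross p q \<noteq> (0, 0, 0)" using L by (rule proj_lineE)
  then have "p \<noteq> 0" by (auto simp: cross_def)
  moreover have "vec.span {p} \<subseteq> L" unfolding pq(1) by (rule vec.span_mono) simp
  ultimately show ?thesis using span_point True by blast
next
  case False
  with proj_lines_inter[OF L M] show ?thesis by blast
qed

lemma line_eq_span:
  assumes "L \<in> proj_lines" "p \<in> L" "q \<in> L" "p \<noteq> 0" "q \<notin> vec.span {p}"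
  shows "L = vec.span {p, q}"
proof -
  have "cross p q \<noteq> (0, 0, 0)"
  proof
    assume "cross p q = (0, 0, 0)"
    then have "vec.dim (vec.span {p, q}) \<le> vec.dim (vec.span {p})"
      using cross_eq_0_dim[of p q] span_point[OF \<open>p \<noteq> 0\<close>] unfolding proj_points_def mem_Collect_eq
      by linarith
    then have "vec.span {p} = vec.span {p, q}"
      by (intro vec.subspace_dim_equal vec.span_mono) auto
    with \<open>q \<notin> vec.span {p}\<close> show False using vec.span_base[of q "{p, q}"] by simp
  qed
  then have "vec.span {p, q} \<in> proj_lines" by (rule span_pair_line)
  moreover have "vec.span {p, q} \<subseteq> L"
    using assms by (intro vec.span_minimal) (auto simp: proj_lines_def)
  ultimately show ?thesis using assms(1)
    by (intro vec.subspace_dim_equal[symmetric]) (auto simp: proj_lines_def)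
qed

section \<open>Arrangements with double and quadruple points\<close>

text \<open>Everything is read off from the index set \<open>S P\<close> of the lines through a
  point. Points on at least three lines correspond to members of \<open>\<Q>\<close>, points on
  exactly two lines to pairs inside no member; both maps are injective because two distinct lines
  determine their common point.\<close>

lemma arrangement_counts:
  fixes L :: "nat \<Rightarrow> (complex ^ 3) set" and n :: nat and \<Q> :: "nat set set"
  defines "A \<equiv> L ` {..<n}"
  assumes lines: "\<And>i. i < n \<Longrightarrow> L i \<in> proj_lines" and inj: "inj_on L {..<n}"
    and triples: "\<And>i j k P. i < n \<Longrightarrow> j < n \<Longrightarrow> k < n \<Longrightarrow> i \<noteq> j \<Longrightarrow> i \<noteq> k \<Longrightarrow> j \<noteq> k \<Longrightarrow>
       P \<in> proj_points \<Longrightarrow> P \<subseteq> L i \<Longrightarrow> P \<subseteq> L j \<Longrightarrow> P \<subseteq> L k \<Longrightarrow> \<exists>Q\<in>\<Q>. {i, j, k} \<subseteq> Q"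
    and quad_card: "\<And>Q. Q \<in> \<Q> \<Longrightarrow> Q \<subseteq> {..<n} \<and> card Q = 4"
    and quad_point: "\<And>Q. Q \<in> \<Q> \<Longrightarrow> \<exists>P\<in>proj_points. \<forall>i\<in>Q. P \<subseteq> L i"
    and quad_inter: "\<And>Q Q' i j. Q \<in> \<Q> \<Longrightarrow> Q' \<in> \<Q> \<Longrightarrow> {i, j} \<subseteq> Q \<inter> Q' \<Longrightarrow> i \<noteq> j \<Longrightarrow> Q = Q'"
  shows "card (quadruple_points A) = card \<Q>"
    and "card (double_points A) = card {(i, j). i < j \<and> j < n \<and> (\<forall>Q\<in>\<Q>. \<not> {i, j} \<subseteq> Q)}"
    and "intersection_points A = double_points A \<union> quadruple_points A"
proof -
  define S where "S P = {i. i < n \<and> P \<subseteq> L i}" for P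
  define pairs where "pairs = {(i, j). i < j \<and> j < n \<and> (\<forall>Q\<in>\<Q>. \<not> {i, j} \<subseteq> Q)}"
  have fin: "finite (S P)" for P by (simp add: S_def)
  have L_neq: "L i \<noteq> L j" if "i < n" "j < n" "i \<noteq> j" for i j
    using inj_onD[OF inj, of i j] that by auto
  have through: "card (lines_through A P) = card (S P)" for P
  proof -
    have "lines_through A P = L ` S P" by (auto simp: lines_through_def A_def S_def)
    moreover have "inj_on L (S P)" by (rule inj_on_subset[OF inj]) (auto simp: S_def)
    ultimately show ?thesis by (simp add: card_image)
  qed
  have two: "2 \<le> card (S P)" if "i \<in> S P" "j \<in> S P" "i \<noteq> j" for i j P
    using card_mono[OF fin, of "{i, j}" P] that by simp
  have two_obtain: "\<exists>i j. i \<in> S P \<and> j \<in> S P \<and> i < j" if "2 \<le> card (S P)" for P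
  proof -
    have "\<not> is_singleton (S P)" "S P \<noteq> {}" using that by (auto simp: is_singleton_altdef)
    then obtain i j where "i \<in> S P" "j \<in> S P" "i \<noteq> j"
      by (metis ex_in_conv is_singletonI')
    then show ?thesis by (metis nat_neq_iff)
  qed
  have eq: "P = L i \<inter> L j" if "P \<in> proj_points" "i \<in> S P" "j \<in> S P" "i \<noteq> j" for P i j
    using that by (simp add: proj_point_eq_inter lines L_neq S_def)
  \<comment> \<open>The pair \<open>i\<close>, \<open>j\<close> lies in a single member
    \<open>Q\<close>, so every further line through \<open>P\<close> has its index in
    \<open>Q\<close>. Conversely the common point of \<open>Q\<close> is
    \<open>L i \<inter> L j\<close>, which is \<open>P\<close>.\<close>
  have S_quad: "S P \<in> \<Q>" if P: "P \<in> proj_points" and c: "3 \<le> card (S P)" for P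
  proof -
    obtain i j where ij: "i \<in> S P" "j \<in> S P" "i < j" using two_obtain[of P] c by auto
    have tr: "\<exists>Q\<in>\<Q>. {i, j, k} \<subseteq> Q" if "k \<in> S P" "k \<noteq> i" "k \<noteq> j" for k
      using triples[of i j k P] that ij P by (auto simp: S_def)
    have "\<not> S P \<subseteq> {i, j}"
      using card_mono[of "{i, j}" "S P"] c ij by auto
    then obtain k where "k \<in> S P" "k \<noteq> i" "k \<noteq> j" by auto
    from tr[OF this] obtain Q where Q: "Q \<in> \<Q>" "{i, j, k} \<subseteq> Q" by blast
    have "S P \<subseteq> Q"
    proof
      fix m assume m: "m \<in> S P"
      show "m \<in> Q"
      proof (cases "m = i \<or> m = j")
        case False
        with tr m obtain Q' where "Q' \<in> \<Q>" "{i, j, m} \<subseteq> Q'" by blast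
        with quad_inter[of Q Q' i j] Q ij show ?thesis by auto
      qed (use Q in auto)
    qed
    moreover have "Q \<subseteq> S P"
    proof -
      obtain R where R: "R \<in> proj_points" "\<forall>i\<in>Q. R \<subseteq> L i" using quad_point[OF Q(1)] by blast
      have "Q \<subseteq> S R" using R quad_card[OF Q(1)] by (auto simp: S_def)
      with eq[OF R(1), of i j] eq[OF P, of i j] Q ij have "R = P" by auto
      with \<open>Q \<subseteq> S R\<close> show ?thesis by simp
    qed
    ultimately show ?thesis using Q by simp
  qed
  \<comment> \<open>A common point of the lines in \<open>Q\<close> might lie on further lines; but
    \<open>S P\<close> is then a member itself and shares two indices with \<open>Q\<close>.\<close>
  have quad_S: "\<exists>P\<in>proj_points. S P = Q" if Q: "Q \<in> \<Q>" for Q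
  proof -
    obtain P where P: "P \<in> proj_points" "\<forall>i\<in>Q. P \<subseteq> L i" using quad_point[OF Q] by blast
    have sub: "Q \<subseteq> S P" using P quad_card[OF Q] by (auto simp: S_def)
    have "4 \<le> card (S P)" using card_mono[OF fin sub] quad_card[OF Q] by simp
    then have "S P \<in> \<Q>" using S_quad P by simp
    moreover obtain i j where "i \<in> Q" "j \<in> Q" "i \<noteq> j"
    proof -
      have "\<not> is_singleton Q" "Q \<noteq> {}" using quad_card[OF Q] by (auto simp: is_singleton_altdef)
      then show ?thesis using that by (metis ex_in_conv is_singletonI')
    qed
    ultimately have "S P = Q" using quad_inter[of "S P" Q i j] Q sub by blast
    with P show ?thesis by blast
  qed
  have S_inj: "P = R"
    if "P \<in> proj_points" "R \<in> proj_points" "S P = S R" "2 \<le> card (S P)" for P R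
    using two_obtain[OF that(4)] eq[OF that(1)] eq[OF that(2)] that(3) by (metis less_irrefl)
  have quadruple: "quadruple_points A = {P \<in> proj_points. S P \<in> \<Q>}"
    using S_quad quad_card by (auto simp: k_fold_points_def through)
  have "bij_betw S (quadruple_points A) \<Q>"
    unfolding bij_betw_def
  proof
    show "inj_on S (quadruple_points A)"
      by (rule inj_onI, rule S_inj) (auto simp: k_fold_points_def through)
    show "S ` quadruple_points A = \<Q>"
      using quad_S by (auto simp: quadruple)
  qed
  then show "card (quadruple_points A) = card \<Q>" by (rule bij_betw_same_card)

  \<comment> \<open>A third line through the intersection would make \<open>S ?P\<close> a member of
    \<open>\<Q>\<close> containing the pair.\<close>
  have pair_S: "L i \<inter> L j \<in> proj_points \<and> S (L i \<inter> L j) = {i, j}" if "(i, j) \<in> pairs" for i j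
  proof -
    let ?P = "L i \<inter> L j"
    from that have ij: "i < j" "j < n" "\<forall>Q\<in>\<Q>. \<not> {i, j} \<subseteq> Q" by (auto simp: pairs_def)
    have P: "?P \<in> proj_points"
      using ij by (simp add: proj_lines_inter lines L_neq)
    have sub: "{i, j} \<subseteq> S ?P" using ij by (auto simp: S_def)
    then have "S ?P \<notin> \<Q>" using ij by blast
    then have "card (S ?P) \<le> 2" using S_quad[OF P] by force
    then have "{i, j} = S ?P" using ij by (intro card_seteq[OF fin sub]) auto
    with P show ?thesis by simp
  qed
  have "bij_betw (\<lambda>(i, j). L i \<inter> L j) pairs (double_points A)"
    unfolding bij_betw_def
  proof
    show "inj_on (\<lambda>(i, j). L i \<inter> L j) pairs"
    proof (rule inj_onI, clarify)
      fix i j k l assume *: "(i, j) \<in> pairs" "(k, l) \<in> pairs" "L i \<inter> L j = L k \<inter> L l"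
      then have "{i, j} = {k, l}" using pair_S by metis
      moreover have "i < j" "k < l" using * by (auto simp: pairs_def)
      ultimately show "i = k \<and> j = l" by (auto simp: doubleton_eq_iff)
    qed
    show "(\<lambda>(i, j). L i \<inter> L j) ` pairs = double_points A"
    proof (intro equalityI subsetI)
      fix P assume "P \<in> (\<lambda>(i, j). L i \<inter> L j) ` pairs"
      then obtain i j where "(i, j) \<in> pairs" "P = L i \<inter> L j" by auto
      with pair_S[of i j] show "P \<in> double_points A"
        by (auto simp: k_fold_points_def through pairs_def)
    next
      fix P assume "P \<in> double_points A"
      then have P: "P \<in> proj_points" "card (S P) = 2" by (auto simp: k_fold_points_def through)
      then obtain i j where ij: "i \<in> S P" "j \<in> S P" "i < j" using two_obtain[of P] by auto
      have "\<not> {i, j} \<subseteq> Q" if Q: "Q \<in> \<Q>" for Q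
      proof
        assume sub: "{i, j} \<subseteq> Q"
        obtain R where R: "R \<in> proj_points" "S R = Q" using quad_S[OF Q] by blast
        then have "R = P" using eq[OF R(1), of i j] eq[OF P(1), of i j] ij sub by auto
        with R P quad_card[OF Q] show False by simp
      qed
      then have "(i, j) \<in> pairs" using ij by (auto simp: pairs_def S_def)
      moreover have "P = L i \<inter> L j" using eq P ij by auto
      ultimately show "P \<in> (\<lambda>(i, j). L i \<inter> L j) ` pairs" by force
    qed
  qed
  then show "card (double_points A) = card {(i, j). i < j \<and> j < n \<and> (\<forall>Q\<in>\<Q>. \<not> {i, j} \<subseteq> Q)}"
    unfolding pairs_def[symmetric] by (rule bij_betw_same_card[symmetric])

  have inter: "intersection_points A = {P \<in> proj_points. 2 \<le> card (S P)}"
  proof (intro equalityI subsetI)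
    fix P assume "P \<in> intersection_points A"
    then obtain i j where "P \<in> proj_points" "i < n" "j < n" "L i \<noteq> L j" "P \<subseteq> L i" "P \<subseteq> L j"
      by (auto simp: intersection_points_def A_def)
    then show "P \<in> {P \<in> proj_points. 2 \<le> card (S P)}"
      using two[of i P j] by (auto simp: S_def)
  next
    fix P assume "P \<in> {P \<in> proj_points. 2 \<le> card (S P)}"
    then obtain i j where *: "P \<in> proj_points" "i \<in> S P" "j \<in> S P" "i < j"
      using two_obtain[of P] by auto
    then have "L i \<in> A" "L j \<in> A" "L i \<noteq> L j" "P \<subseteq> L i" "P \<subseteq> L j"
      by (simp_all add: A_def S_def L_neq)
    with *(1) show "P \<in> intersection_points A"
      unfolding intersection_points_def by blast
  qed
  show "intersection_points A = double_points A \<union> quadruple_points A"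
  proof (intro equalityI subsetI)
    fix P assume "P \<in> intersection_points A"
    then have P: "P \<in> proj_points" "2 \<le> card (S P)" by (auto simp: inter)
    show "P \<in> double_points A \<union> quadruple_points A"
    proof (cases "card (S P) = 2")
      case False
      then show ?thesis using S_quad P by (simp add: quadruple)
    qed (use P in \<open>simp add: k_fold_points_def through\<close>)
  qed (auto simp: inter k_fold_points_def through)
qed

section \<open>Bitangents and squares of binary quadratic forms\<close>

definition quartic_form :: "(complex ^ 3 \<Rightarrow> complex) \<Rightarrow> bool" where
  "quartic_form F \<longleftrightarrow> (\<forall>p q. \<exists>c0 c1 c2 c3 c4. \<forall>s t. F (s *s p + t *s q) =
     c0 * s ^ 4 + c1 * s ^ 3 * t + c2 * s ^ 2 * t ^ 2 + c3 * s * t ^ 3 + c4 * t ^ 4)"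

text \<open>Polynomials that agree at all complex numbers are equal, so the witness \<open>r\<close>
  of \<open>line_cuts\<close> is the explicit polynomial, and its order at 0 is the multiplicity at
  \<open>p\<close>.\<close>

lemma coeffs_eq_0_of_line_cuts:
  assumes "line_cuts F L D" "vec.span {p, q} = L"
    and F: "\<And>t. F (p + t *s q) = c0 + c1 * t + c2 * t ^ 2 + c3 * t ^ 3 + c4 * t ^ 4"
    and "k < count D (vec.span {p})"
  shows "coeff [:c0, c1, c2, c3, c4:] k = 0"
proof -
  obtain r where r: "r \<noteq> 0" "\<And>t. poly r t = F (p + t *s q)" "order 0 r = count D (vec.span {p})"
    using assms(1,2) unfolding line_cuts_def by blast
  have "poly r t = poly [:c0, c1, c2, c3, c4:] t" for t
    unfolding r(2) F by (simp add: algebra_simps power_numeral_reduce)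
  then have "r = [:c0, c1, c2, c3, c4:]" by (rule poly_ext)
  moreover have "monom 1 (order 0 r) dvd r" using monom_1_dvd_iff[OF r(1)] by simp
  then have "coeff r k = 0" using assms(4) r(3) by (simp add: monom_1_dvd_iff')
  ultimately show ?thesis by simp
qed

text \<open>In a basis of \<open>L\<close> adapted to the divisor only one monomial survives, and it
  is a square up to a constant. Substituting the coordinates of \<open>u\<close> and
  \<open>w\<close> keeps it a square.\<close>

lemma bitangent_square:
  assumes F: "quartic_form F" and L: "L \<in> bitangents F" and uw: "u \<in> L" "w \<in> L"
  obtains \<alpha> \<beta> \<gamma> where "\<And>x y. F (x *s u + y *s w) = (\<alpha> * x ^ 2 + \<beta> * x * y + \<gamma> * y ^ 2) ^ 2"
proof -
  obtain P P' where cut: "line_cuts F L {#P, P, P', P'#}" using L by (auto simp: bitangents_def)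
  then have L: "L \<in> proj_lines" and P: "P \<in> proj_points" "P \<subseteq> L" and P': "P' \<in> proj_points" "P' \<subseteq> L"
    by (auto simp: line_cuts_def)
  obtain p where p: "P = vec.span {p}" "p \<noteq> 0" using P proj_pointE by blast
  obtain p' where p': "P' = vec.span {p'}" "p' \<noteq> 0" using P' proj_pointE by blast
  have pL: "p \<in> L" using P p vec.span_base by blast
  have p'L: "p' \<in> L" using P' p' vec.span_base by blast
  \<comment> \<open>\<open>m = n = 1\<close> is the case of two tangency points,
    \<open>m = 0\<close> and \<open>n = 2\<close> that of a hyperflex. The constant \<open>c\<close>
    is absorbed by a complex square root at the end.\<close>
  have "\<exists>q c m n. L = vec.span {p, q} \<and> m + n = 2 \<and>
    (\<forall>s t. F (s *s p + t *s q) = c * (s ^ m * t ^ n) ^ 2)"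
  proof (cases "P = P'")
    case False
    have "p' \<notin> vec.span {p}" using False point_eq_span P(1) p p' by metis
    then have span: "L = vec.span {p, p'}" using line_eq_span L pL p'L p by blast
    obtain c0 c1 c2 c3 c4 where c: "\<And>s t. F (s *s p + t *s p') =
        c0 * s ^ 4 + c1 * s ^ 3 * t + c2 * s ^ 2 * t ^ 2 + c3 * s * t ^ 3 + c4 * t ^ 4"
      using F unfolding quartic_form_def by metis
    have 1: "F (p + t *s p') = c0 + c1 * t + c2 * t ^ 2 + c3 * t ^ 3 + c4 * t ^ 4" for t
      using c[of 1 t] by simp
    \<comment> \<open>Exchanging the base points reverses the coefficients, so the double zero at
      \<open>p'\<close> removes \<open>c4\<close> and \<open>c3\<close>.\<close>
    have 2: "F (p' + t *s p) = c4 + c3 * t + c2 * t ^ 2 + c1 * t ^ 3 + c0 * t ^ 4" for t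
      using c[of t 1] by (simp add: add_ac)
    have "c0 = 0" "c1 = 0"
      using coeffs_eq_0_of_line_cuts[OF cut span[symmetric] 1, of 0]
        coeffs_eq_0_of_line_cuts[OF cut span[symmetric] 1, of 1] p by auto
    moreover have "vec.span {p', p} = L" using span by (simp add: insert_commute)
    then have "c4 = 0" "c3 = 0"
      using coeffs_eq_0_of_line_cuts[OF cut _ 2, of 0]
        coeffs_eq_0_of_line_cuts[OF cut _ 2, of 1] p' by auto
    ultimately have "F (s *s p + t *s p') = c2 * (s ^ 1 * t ^ 1) ^ 2" for s t
      using c by (simp add: power_mult_distrib)
    with span show ?thesis by (metis one_add_one)
  next
    case True
    have "L \<noteq> P" using L P by (auto simp: proj_lines_def proj_points_def)
    then obtain q where q: "q \<in> L" "q \<notin> vec.span {p}" using P p by blast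
    then have span: "L = vec.span {p, q}" using line_eq_span L pL p by blast
    obtain c0 c1 c2 c3 c4 where c: "\<And>s t. F (s *s p + t *s q) =
        c0 * s ^ 4 + c1 * s ^ 3 * t + c2 * s ^ 2 * t ^ 2 + c3 * s * t ^ 3 + c4 * t ^ 4"
      using F unfolding quartic_form_def by metis
    have 1: "F (p + t *s q) = c0 + c1 * t + c2 * t ^ 2 + c3 * t ^ 3 + c4 * t ^ 4" for t
      using c[of 1 t] by simp
    have "coeff [:c0, c1, c2, c3, c4:] k = 0" if "k < 4" for k
      using coeffs_eq_0_of_line_cuts[OF cut span[symmetric] 1, of k] that p True by simp
    from this[of 0] this[of 1] this[of 2] this[of 3]
    have "c0 = 0" "c1 = 0" "c2 = 0" "c3 = 0" by (simp_all add: eval_nat_numeral)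
    then have "F (s *s p + t *s q) = c4 * (s ^ 0 * t ^ 2) ^ 2" for s t
      using c by (simp add: power_mult[symmetric])
    with span show ?thesis by (metis add_0)
  qed
  then obtain q c m n where span: "L = vec.span {p, q}" and mn: "m + n = 2"
    and Fc: "\<And>s t. F (s *s p + t *s q) = c * (s ^ m * t ^ n) ^ 2" by blast
  obtain s1 t1 s2 t2 where u: "u = s1 *s p + t1 *s q" and w: "w = s2 *s p + t2 *s q"
    using uw unfolding span span_pair by blast
  have comb: "x *s u + y *s w = (x * s1 + y * s2) *s p + (x * t1 + y * t2) *s q" for x y
    unfolding u w by (simp add: vec_eq_iff algebra_simps)
  have "\<exists>\<alpha> \<beta> \<gamma>. \<forall>x y. (x * s1 + y * s2) ^ m * (x * t1 + y * t2) ^ n = \<alpha> * x ^ 2 + \<beta> * x * y + \<gamma> * y ^ 2"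
  proof -
    consider "m = 0" "n = 2" | "m = 1" "n = 1" | "m = 2" "n = 0" using mn by linarith
    then show ?thesis
    proof cases
      case 1 show ?thesis unfolding 1
        by (intro exI[of _ "t1 ^ 2"] exI[of _ "2 * t1 * t2"] exI[of _ "t2 ^ 2"])
          (simp add: algebra_simps power2_eq_square)
    next
      case 2 show ?thesis unfolding 2
        by (intro exI[of _ "s1 * t1"] exI[of _ "s1 * t2 + s2 * t1"] exI[of _ "s2 * t2"])
          (simp add: algebra_simps power2_eq_square)
    next
      case 3 show ?thesis unfolding 3
        by (intro exI[of _ "s1 ^ 2"] exI[of _ "2 * s1 * s2"] exI[of _ "s2 ^ 2"])
          (simp add: algebra_simps power2_eq_square)
    qed
  qed
  then obtain \<alpha> \<beta> \<gamma> where
    q: "\<And>x y. (x * s1 + y * s2) ^ m * (x * t1 + y * t2) ^ n = \<alpha> * x ^ 2 + \<beta> * x * y + \<gamma> * y ^ 2"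
    by blast
  show ?thesis
  proof (rule that)
    fix x y
    have "F (x *s u + y *s w) = c * (\<alpha> * x ^ 2 + \<beta> * x * y + \<gamma> * y ^ 2) ^ 2"
      unfolding comb Fc q ..
    also have "\<dots> = (csqrt c * (\<alpha> * x ^ 2 + \<beta> * x * y + \<gamma> * y ^ 2)) ^ 2"
      by (simp add: power_mult_distrib)
    finally show "F (x *s u + y *s w) = (csqrt c * \<alpha> * x ^ 2 + csqrt c * \<beta> * x * y + csqrt c * \<gamma> * y ^ 2) ^ 2"
      by (simp add: algebra_simps)
  qed
qed

lemma binary_quadratic_factors:
  fixes \<alpha> \<beta> \<gamma> :: complex
  obtains a b c d where "\<And>x y. \<alpha> * x ^ 2 + \<beta> * x * y + \<gamma> * y ^ 2 = (a * x + b * y) * (c * x + d * y)"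
proof (cases "\<alpha> = 0")
  case True
  then show ?thesis by (intro that[of 0 1 \<beta> \<gamma>]) (simp add: algebra_simps power2_eq_square)
next
  case False
  define D where "D = csqrt (\<beta> ^ 2 - 4 * \<alpha> * \<gamma>)"
  have D: "D * D = \<beta> * \<beta> - 4 * \<alpha> * \<gamma>"
    unfolding D_def by (metis power2_csqrt power2_eq_square)
  show ?thesis
  proof (rule that)
    fix x y
    have "(\<alpha> * x + (\<beta> + D) / 2 * y) * (1 * x + (\<beta> - D) / (2 * \<alpha>) * y) =
       \<alpha> * x ^ 2 + \<beta> * x * y + (\<beta> * \<beta> - D * D) / (4 * \<alpha>) * y ^ 2"
      using False by (simp add: field_simps power2_eq_square)
    also have "(\<beta> * \<beta> - D * D) / (4 * \<alpha>) = \<gamma>" using False by (simp add: D)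
    finally show "\<alpha> * x ^ 2 + \<beta> * x * y + \<gamma> * y ^ 2 =
       (\<alpha> * x + (\<beta> + D) / 2 * y) * (1 * x + (\<beta> - D) / (2 * \<alpha>) * y)" ..
  qed
qed

lemma order_0_linear:
  fixes e f :: "'a::idom"
  assumes "e \<noteq> 0 \<or> f \<noteq> 0"
  shows "order 0 [:e, f:] = (if e = 0 then 1 else 0)"
proof (cases "e = 0")
  case True
  then have "[:e, f:] = smult f [:- 0, 1:]" by simp
  then show ?thesis using assms True order_power_n_n[of 0 1] by (simp add: order_smult del: smult_pCons)
next
  case False
  then show ?thesis by (simp add: order_0I)
qed

text \<open>The quadratic form splits into two linear factors, whose zeros are the tangency points.
  Along \<open>p + t q\<close> a factor vanishes at \<open>t = 0\<close>, to order one, exactly when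
  \<open>p\<close> spans its zero; after squaring, the orders are the counts in the divisor, also
  when the two zeros coincide.\<close>

lemma bitangentI:
  assumes ind: "cross u w \<noteq> (0, 0, 0)"
    and F: "\<And>x y. F (x *s u + y *s w) = (\<alpha> * x ^ 2 + \<beta> * x * y + \<gamma> * y ^ 2) ^ 2"
    and nz: "\<alpha> \<noteq> 0 \<or> \<beta> \<noteq> 0 \<or> \<gamma> \<noteq> 0"
  shows "vec.span {u, w} \<in> bitangents F"
proof -
  obtain a b c d where fac: "\<And>x y. \<alpha> * x ^ 2 + \<beta> * x * y + \<gamma> * y ^ 2 = (a * x + b * y) * (c * x + d * y)"
    using binary_quadratic_factors[of \<alpha> \<beta> \<gamma>] by blast
  have ab: "a \<noteq> 0 \<or> b \<noteq> 0" and cd: "c \<noteq> 0 \<or> d \<noteq> 0"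
  proof -
    have "\<not> (\<forall>x y. \<alpha> * x ^ 2 + \<beta> * x * y + \<gamma> * y ^ 2 = 0)"
    proof
      assume *: "\<forall>x y. \<alpha> * x ^ 2 + \<beta> * x * y + \<gamma> * y ^ 2 = 0"
      from spec[OF spec[OF *, of 1], of 0] spec[OF spec[OF *, of 0], of 1] spec[OF spec[OF *, of 1], of 1] nz
      show False by simp
    qed
    then show "a \<noteq> 0 \<or> b \<noteq> 0" "c \<noteq> 0 \<or> d \<noteq> 0" unfolding fac by auto
  qed
  have coords: "x = x' \<and> y = y'" if "x *s u + y *s w = x' *s u + y' *s w" for x y x' y'
  proof -
    have e: "(x - x') * u $ i + (y - y') * w $ i = 0" for i
      using arg_cong[OF that, of "\<lambda>v. v $ i"] by (simp add: algebra_simps)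
    have m: "(x - x') * (u $ i * w $ j - u $ j * w $ i) = 0" "(y - y') * (u $ i * w $ j - u $ j * w $ i) = 0" for i j
      using e[of i] e[of j] by algebra+
    obtain i j where "u $ i * w $ j - u $ j * w $ i \<noteq> 0" using ind by (auto simp: cross_def)
    with m[of i j] show ?thesis by simp
  qed
  define L where "L = vec.span {u, w}"
  \<comment> \<open>\<open>(x, y) = (b, - a)\<close> is the zero of the linear form
    \<open>a x + b y\<close>.\<close>
  define P where "P a b = vec.span {b *s u - a *s w}" for a b
  have L: "L \<in> proj_lines" unfolding L_def using ind by (rule span_pair_line)
  have P: "P a b \<in> proj_points \<and> P a b \<subseteq> L" if "a \<noteq> 0 \<or> b \<noteq> 0" for a b
  proof -
    have "b *s u - a *s w \<noteq> 0"
      using coords[of b "- a" 0 0] that by auto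
    moreover have "b *s u - a *s w \<in> L" unfolding L_def
      by (intro vec.span_diff vec.span_scale vec.span_base) auto
    ultimately show ?thesis unfolding P_def using L
      by (intro conjI span_point vec.span_minimal) (simp_all add: proj_lines_def)
  qed
  have on: "vec.span {x *s u + y *s w} = P a b \<longleftrightarrow> a * x + b * y = 0"
    if "a \<noteq> 0 \<or> b \<noteq> 0" "x *s u + y *s w \<noteq> 0" for a b x y
  proof
    assume "vec.span {x *s u + y *s w} = P a b"
    then have "x *s u + y *s w \<in> P a b" using vec.span_base by blast
    then obtain k where "x *s u + y *s w = k *s (b *s u - a *s w)"
      unfolding P_def vec.span_singleton by blast
    then have "x *s u + y *s w = (k * b) *s u + (- k * a) *s w"
      by (simp add: vec_eq_iff algebra_simps)
    from coords[OF this] show "a * x + b * y = 0" by simp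
  next
    assume eq: "a * x + b * y = 0"
    have "x *s u + y *s w = (if b \<noteq> 0 then x / b else - y / a) *s (b *s u - a *s w)"
      using eq that(1) by (auto simp: vec_eq_iff field_simps) (algebra+)?
    then have "x *s u + y *s w \<in> P a b" unfolding P_def vec.span_singleton by blast
    then show "vec.span {x *s u + y *s w} = P a b"
      using point_eq_span P that by blast
  qed
  have "line_cuts F L {#P a b, P a b, P c d, P c d#}"
    unfolding line_cuts_def
  proof (intro conjI allI impI)
    show "L \<in> proj_lines" by (rule L)
    show "\<forall>Q\<in>#{#P a b, P a b, P c d, P c d#}. Q \<in> proj_points \<and> Q \<subseteq> L"
      using P ab cd by auto
  next
    fix p q assume pq: "vec.span {p, q} = L"
    then have "cross p q \<noteq> (0, 0, 0)" using L proj_line_span_iff by metis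
    obtain x1 y1 x2 y2 where p: "p = x1 *s u + y1 *s w" and q: "q = x2 *s u + y2 *s w"
      using vec.span_base[of p "{p, q}"] vec.span_base[of q "{p, q}"] pq
      unfolding L_def span_pair[of u w] by auto
    \<comment> \<open>The change of basis from \<open>u\<close>, \<open>w\<close> to
      \<open>p\<close>, \<open>q\<close> is invertible, so no linear factor becomes the zero
      polynomial in \<open>t\<close>.\<close>
    have det: "x1 * y2 - x2 * y1 \<noteq> 0"
    proof
      assume 0: "x1 * y2 - x2 * y1 = 0"
      have "p $ i * q $ j - p $ j * q $ i = (x1 * y2 - x2 * y1) * (u $ i * w $ j - u $ j * w $ i)" for i j
        unfolding p q by (simp add: algebra_simps)
      then have "cross p q = (0, 0, 0)" unfolding cross_def 0 by simp
      with \<open>cross p q \<noteq> (0, 0, 0)\<close> show False ..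
    qed
    define l where "l a b = [:a * x1 + b * y1, a * x2 + b * y2:]" for a b
    have l_nz: "a * x1 + b * y1 \<noteq> 0 \<or> a * x2 + b * y2 \<noteq> 0" if "a \<noteq> 0 \<or> b \<noteq> 0" for a b
    proof (rule ccontr)
      assume "\<not> ?thesis"
      then have "a * (x1 * y2 - x2 * y1) = 0" "b * (x1 * y2 - x2 * y1) = 0" by algebra+
      with det that show False by simp
    qed
    have "p \<noteq> 0" using \<open>cross p q \<noteq> (0, 0, 0)\<close> by (auto simp: cross_def)
    have order_l: "order 0 (l a b) = (if vec.span {p} = P a b then 1 else 0)" if "a \<noteq> 0 \<or> b \<noteq> 0" for a b
      using on[OF that, of x1 y1] \<open>p \<noteq> 0\<close> p l_nz[OF that] unfolding l_def
      by (simp add: order_0_linear)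
    have ll: "l a b \<noteq> 0" "l c d \<noteq> 0" using l_nz[OF ab] l_nz[OF cd] by (auto simp: l_def)
    show "\<exists>r. r \<noteq> 0 \<and> (\<forall>t. poly r t = F (p + t *s q)) \<and>
        order 0 r = count {#P a b, P a b, P c d, P c d#} (vec.span {p})"
    proof (intro exI conjI allI)
      show "(l a b * l c d) ^ 2 \<noteq> 0" using ll by simp
      fix t
      have "p + t *s q = (x1 + t * x2) *s u + (y1 + t * y2) *s w"
        unfolding p q by (simp add: vec_eq_iff algebra_simps)
      then have "F (p + t *s q) =
          ((a * (x1 + t * x2) + b * (y1 + t * y2)) * (c * (x1 + t * x2) + d * (y1 + t * y2))) ^ 2"
        by (simp only: F fac)
      then show "poly ((l a b * l c d) ^ 2) t = F (p + t *s q)"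
        by (simp add: l_def algebra_simps)
      show "order 0 ((l a b * l c d) ^ 2) = count {#P a b, P a b, P c d, P c d#} (vec.span {p})"
        using ll by (simp add: order_mult power2_eq_square order_l[OF ab] order_l[OF cd])
    qed
  qed
  then show ?thesis unfolding bitangents_def L_def by blast
qed

section \<open>Bitangents of the Komiya--Kuribayashi quartic\<close>

text \<open>The quartic is a quadratic form in the squared coordinates, and each squared coordinate
  is a binary quadratic form in \<open>s\<close> and \<open>t\<close>.\<close>

lemma quartic_form_kk: "quartic_form komiya_kuribayashi"
  unfolding quartic_form_def
proof (intro allI)
  fix p q :: "complex ^ 3"
  have sq: "(s * a + t * b) ^ 2 = a ^ 2 * s ^ 2 + 2 * a * b * s * t + b ^ 2 * t ^ 2" for a b s t :: complex
    by (simp add: power2_eq_square algebra_simps)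
  have pow4: "a ^ 4 = (a ^ 2) ^ 2" for a :: complex by simp
  \<comment> \<open>The symmetric matrix of that quadratic form; a mixed term occurs twice in the
    double sum, hence half of 3.\<close>
  define A where "A i j = (if i = j then 1 else 3 / 2 :: complex)" for i j :: 3
  define X where "X i = p $ i ^ 2" for i
  define Y where "Y i = 2 * p $ i * q $ i" for i
  define Z where "Z i = q $ i ^ 2" for i
  define S where "S U V = (\<Sum>i\<in>UNIV. \<Sum>j\<in>UNIV. A i j * U i * V j)" for U V :: "3 \<Rightarrow> complex"
  have "komiya_kuribayashi (s *s p + t *s q) =
      S X X * s ^ 4 + 2 * S X Y * s ^ 3 * t + (2 * S X Z + S Y Y) * s ^ 2 * t ^ 2 + 2 * S Y Z * s * t ^ 3 + S Z Z * t ^ 4"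
    for s t
  proof -
    have v: "((s *s p + t *s q) $ i) ^ 2 = X i * s ^ 2 + Y i * s * t + Z i * t ^ 2" for i
      by (simp add: sq X_def Y_def Z_def)
    show ?thesis
      unfolding komiya_kuribayashi_def Let_def pow4[of "_ $ _"] v S_def sum_3 A_def
      by (simp add: algebra_simps power2_eq_square eval_nat_numeral)
  qed
  then show "\<exists>c0 c1 c2 c3 c4. \<forall>s t. komiya_kuribayashi (s *s p + t *s q) =
      c0 * s ^ 4 + c1 * s ^ 3 * t + c2 * s ^ 2 * t ^ 2 + c3 * s * t ^ 3 + c4 * t ^ 4" by metis
qed

text \<open>\<open>(p, q, r)\<close> stands for the line \<open>p x + q y + r z = 0\<close>.\<close>

definition kk_bitangent_coeffs :: "complex \<times> complex \<times> complex \<Rightarrow> bool" where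
  "kk_bitangent_coeffs = (\<lambda>(p, q, r).
     p = 0 \<and> 5 * q ^ 4 + 6 * q ^ 2 * r ^ 2 + 5 * r ^ 4 = 0 \<or>
     q = 0 \<and> 5 * p ^ 4 + 6 * p ^ 2 * r ^ 2 + 5 * r ^ 4 = 0 \<or>
     r = 0 \<and> 5 * p ^ 4 + 6 * p ^ 2 * q ^ 2 + 5 * q ^ 4 = 0 \<or>
     p ^ 2 = q ^ 2 \<and> q ^ 2 = r ^ 2 \<or>
     p ^ 2 = q ^ 2 \<and> r ^ 2 = - 4 * p ^ 2 \<or>
     p ^ 2 = r ^ 2 \<and> q ^ 2 = - 4 * p ^ 2 \<or>
     q ^ 2 = r ^ 2 \<and> p ^ 2 = - 4 * q ^ 2)"

section \<open>Comparing the restriction with a square, coefficient by coefficient\<close>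

lemma quartic_eq_square_coeffs:
  fixes \<alpha> \<beta> \<gamma> :: complex
  assumes "\<And>x y. c0 * x ^ 4 + c1 * x ^ 3 * y + c2 * x ^ 2 * y ^ 2 + c3 * x * y ^ 3 + c4 * y ^ 4 =
     (\<alpha> * x ^ 2 + \<beta> * x * y + \<gamma> * y ^ 2) ^ 2"
  shows "c0 = \<alpha> ^ 2" "c1 = 2 * \<alpha> * \<beta>" "c2 = \<beta> ^ 2 + 2 * \<alpha> * \<gamma>" "c3 = 2 * \<beta> * \<gamma>" "c4 = \<gamma> ^ 2"
proof -
  have "poly [:c0, c1, c2, c3, c4:] t = poly ([:\<alpha>, \<beta>, \<gamma>:] ^ 2) t" for t
    using assms[of 1 t] by (simp add: algebra_simps power_numeral_reduce)
  then have "[:c0, c1, c2, c3, c4:] = [:\<alpha>, \<beta>, \<gamma>:] ^ 2" by (rule poly_ext)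
  then show "c0 = \<alpha> ^ 2" "c1 = 2 * \<alpha> * \<beta>" "c2 = \<beta> ^ 2 + 2 * \<alpha> * \<gamma>" "c3 = 2 * \<beta> * \<gamma>" "c4 = \<gamma> ^ 2"
    by (simp_all add: power2_eq_square algebra_simps)
qed

text \<open>This is the line \<open>z = b y\<close>. Only even powers occur, so
  \<open>\<beta> = 0\<close>, and the middle coefficient squared is four times the product of the
  outer ones.\<close>

lemma biquadratic_square:
  fixes \<alpha> \<beta> \<gamma> :: complex
  assumes "1 = \<alpha> ^ 2" "0 = 2 * \<alpha> * \<beta>" "3 * (1 + b ^ 2) = \<beta> ^ 2 + 2 * \<alpha> * \<gamma>" "1 + b ^ 4 + 3 * b ^ 2 = \<gamma> ^ 2"
  shows "5 * b ^ 4 + 6 * b ^ 2 + 5 = 0"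
proof -
  have "\<beta> = 0" using assms by auto
  then have "3 * (1 + b ^ 2) = 2 * \<alpha> * \<gamma>" using assms by simp
  then have "(3 * (1 + b ^ 2)) ^ 2 = 4 * \<alpha> ^ 2 * \<gamma> ^ 2" by (simp add: power_mult_distrib)
  then show ?thesis unfolding assms(1)[symmetric] assms(4)[symmetric] by algebra
qed

lemma square_imp_coeffs:
  fixes \<alpha> \<beta> \<gamma> :: complex
  assumes 0: "1 + a ^ 4 + 3 * a ^ 2 = \<alpha> ^ 2" and 1: "2 * a * b * (2 * a ^ 2 + 3) = 2 * \<alpha> * \<beta>"
    and 2: "6 * a ^ 2 * b ^ 2 + 3 + 3 * a ^ 2 + 3 * b ^ 2 = \<beta> ^ 2 + 2 * \<alpha> * \<gamma>"
    and 3: "2 * a * b * (2 * b ^ 2 + 3) = 2 * \<beta> * \<gamma>" and 4: "1 + b ^ 4 + 3 * b ^ 2 = \<gamma> ^ 2"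
  shows "kk_bitangent_coeffs (a, b, -1)"
proof -
  consider "a = 0" | "b = 0" | "a \<noteq> 0" "b \<noteq> 0" by blast
  then show ?thesis
  proof cases
    case 1
    then have "5 * b ^ 4 + 6 * b ^ 2 + 5 = 0"
      using biquadratic_square[of \<alpha> \<beta> b \<gamma>] assms by simp
    with 1 show ?thesis by (simp add: kk_bitangent_coeffs_def)
  next
    case 2
    then have "5 * a ^ 4 + 6 * a ^ 2 + 5 = 0"
      using biquadratic_square[of \<gamma> \<beta> a \<alpha>] assms by (simp add: algebra_simps)
    with 2 show ?thesis by (simp add: kk_bitangent_coeffs_def)
  next
    case 3
    define A where "A = a ^ 2"
    define B where "B = b ^ 2"
    define U where "U = A ^ 2 + 3 * A + 1"
    have AB: "A \<noteq> 0" "B \<noteq> 0" using 3 by (simp_all add: A_def B_def)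
    have p4: "a ^ 4 = A ^ 2" "b ^ 4 = B ^ 2" by (simp_all add: A_def B_def)
    have E0: "\<alpha> ^ 2 = U" using assms(1) unfolding p4 A_def[symmetric] U_def by (simp add: algebra_simps)
    have E4: "\<gamma> ^ 2 = B ^ 2 + 3 * B + 1" using assms(5) unfolding p4 B_def[symmetric] by (simp add: algebra_simps)
    have cancel: "x = y" if "2 * x = 2 * y" for x y :: complex using that by simp
    have E1: "\<alpha> * \<beta> = a * b * (2 * A + 3)"
      by (rule cancel) (use assms(2) in \<open>simp only: A_def mult.assoc\<close>)
    have E3: "\<beta> * \<gamma> = a * b * (2 * B + 3)"
      by (rule cancel) (use assms(4) in \<open>simp only: B_def mult.assoc\<close>)
    have E2: "6 * A * B + 3 + 3 * A + 3 * B = \<beta> ^ 2 + 2 * \<alpha> * \<gamma>" using assms(3) by (simp add: A_def B_def)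
    have ab2: "(a * b * k) ^ 2 = A * B * k ^ 2" for k
      by (simp add: power_mult_distrib A_def B_def)
    \<comment> \<open>Eliminates \<open>\<alpha>\<close>, \<open>\<beta>\<close>,
      \<open>\<gamma>\<close> from all coefficients but the middle one.\<close>
    have "(\<alpha> * \<beta>) ^ 2 * \<gamma> ^ 2 = (\<beta> * \<gamma>) ^ 2 * \<alpha> ^ 2" by algebra
    then have "A * B * ((2 * A + 3) ^ 2 * (B ^ 2 + 3 * B + 1) - (2 * B + 3) ^ 2 * (A ^ 2 + 3 * A + 1)) = 0"
      unfolding E0 E1 E3 E4 U_def ab2 by algebra
    then have "(2 * A + 3) ^ 2 * (B ^ 2 + 3 * B + 1) - (2 * B + 3) ^ 2 * (A ^ 2 + 3 * A + 1) = 0"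
      using AB by simp
    \<comment> \<open>\<open>(2 * A + 3) ^ 2\<close> is four times \<open>A ^ 2 + 3 * A + 1\<close>
      plus 5, and likewise for \<open>B\<close>. The products cancel, and five times the difference
      of the two quadratics remains.\<close>
    also have "(2 * A + 3) ^ 2 * (B ^ 2 + 3 * B + 1) - (2 * B + 3) ^ 2 * (A ^ 2 + 3 * A + 1) =
        5 * ((B - A) * (A + B + 3))"
      by (simp add: algebra_simps power2_eq_square)
    finally have "A = B \<or> A + B + 3 = 0" by auto
    then consider "A = B" | "B = - 3 - A" "2 * A + 3 \<noteq> 0"
    proof
      assume "A + B + 3 = 0"
      moreover have "B = (A + B + 3) - 3 - A" by simp
      ultimately have B: "B = - 3 - A" by simp
      have "A - B = 2 * A + 3" unfolding B by simp
      show thesis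
      proof (cases "A = B")
        case False
        then have "2 * A + 3 \<noteq> 0" unfolding \<open>A - B = 2 * A + 3\<close>[symmetric] by simp
        with B show ?thesis by (rule that(2))
      qed (rule that(1))
    qed
    then show ?thesis
    proof cases
      case 1
      have E4': "\<gamma> ^ 2 = U" using E4 1 by (simp add: U_def)
      have E2': "6 * A ^ 2 + 6 * A + 3 = \<beta> ^ 2 + 2 * \<alpha> * \<gamma>" using E2[folded 1] by (simp add: power2_eq_square algebra_simps)
      show ?thesis
      \<comment> \<open>At \<open>A = B = - 3 / 2\<close> both factors vanish and
        \<open>\<beta> = 0\<close>, so \<open>\<beta>\<close> cannot be cancelled to get
        \<open>\<gamma> = \<alpha>\<close>. There the middle coefficient yields 225/4 =
        25/4.\<close>
      proof (cases "2 * A + 3 = 0")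
        case True
        then have A: "A = - 3 / 2" by (simp add: field_simps add_eq_0_iff)
        have "U = - 5 / 4" unfolding U_def A by (simp add: power2_eq_square)
        then have "\<alpha> \<noteq> 0" using E0 by auto
        then have "\<beta> = 0" using E1 True by auto
        then have "15 / 2 = 2 * \<alpha> * \<gamma>" using E2' unfolding A by (simp add: power2_eq_square)
        then have "(15 / 2) ^ 2 = 2 ^ 2 * \<alpha> ^ 2 * \<gamma> ^ 2" by (simp only: power_mult_distrib)
        then show ?thesis unfolding E0 E4' \<open>U = - 5 / 4\<close> by (simp add: power2_eq_square)
      next
        case False
        then have nz: "\<alpha> * \<beta> \<noteq> 0" unfolding E1 using 3 by simp
        have "\<beta> * \<gamma> = \<beta> * \<alpha>" using E1 E3 1 by (simp add: mult.commute)
        then have g: "\<gamma> = \<alpha>" using nz by simp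
        \<comment> \<open>Multiplying the middle coefficient by \<open>\<alpha> ^ 2 = U\<close>
          leaves only quantities known in terms of \<open>A\<close>.\<close>
        have "(6 * A ^ 2 + 6 * A + 3) * U = (\<alpha> * \<beta>) ^ 2 + 2 * U ^ 2"
          unfolding E2' g E0[symmetric] by algebra
        then have "(6 * A ^ 2 + 6 * A + 3) * U = A * A * (2 * A + 3) ^ 2 + 2 * U ^ 2"
          unfolding E1 ab2 1[symmetric] .
        then have "(4 * A + 1) * (A - 1) = 0" unfolding U_def by algebra
        then have "4 * A + 1 = 0 \<or> A = 1" by simp
        moreover have "A = ((4 * A + 1) - 1) / 4" by simp
        ultimately have "A = 1 \<or> A = - 1 / 4" by (metis diff_0)
        then show ?thesis using 1 unfolding kk_bitangent_coeffs_def A_def[symmetric] B_def[symmetric] prod.case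
          by auto
      qed
    next
      case 2
      have nz: "\<alpha> * \<beta> \<noteq> 0" unfolding E1 using 3 2 by simp
      have neg: "2 * B + 3 = - (2 * A + 3)" using 2 by simp
      have "\<beta> * \<gamma> = - (\<alpha> * \<beta>)" unfolding E1 E3 neg by (simp only: mult_minus_right)
      then have "\<beta> * \<gamma> = \<beta> * - \<alpha>" by (simp only: mult_minus_right mult.commute)
      then have g: "\<gamma> = - \<alpha>" using nz by (metis mult_cancel_left mult_eq_0_iff)
      have "(6 * A * B + 3 + 3 * A + 3 * B) * U = (\<alpha> * \<beta>) ^ 2 - 2 * U ^ 2"
        unfolding E2 g E0[symmetric] by algebra
      also have "(\<alpha> * \<beta>) ^ 2 = A * B * (2 * A + 3) ^ 2"
        unfolding E1 by (rule ab2)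
      \<comment> \<open>Here \<open>A * B = 1 - U\<close> and
        \<open>(2 * A + 3) ^ 2 = 4 * U + 5\<close>, and the equation collapses to
        \<open>U = 5\<close>.\<close>
      finally have "(A - 1) * (A + 4) = 0" unfolding U_def 2(1) by algebra
      then have "A = 1 \<or> A = - 4" by (simp add: eq_neg_iff_add_eq_0)
      then have "A = 1 \<and> B = - 4 \<or> A = - 4 \<and> B = 1" using 2(1) by auto
      then show ?thesis unfolding kk_bitangent_coeffs_def A_def[symmetric] B_def[symmetric] prod.case
        by auto
    qed
  qed
qed

section \<open>The three charts of lines: z = a x + b y, y = a x, x = 0\<close>

lemma line_of_z:
  fixes a b :: complex
  defines "u \<equiv> vector [1, 0, a]" and "w \<equiv> vector [0, 1, b]"
  shows "cross u w \<noteq> (0, 0, 0)" "line_of (a, b, -1) = vec.span {u, w}"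
proof -
  have c: "cross u w = (- 1 * a, - 1 * b, - 1 * - 1)" by (simp add: cross_def u_def w_def)
  then show nz: "cross u w \<noteq> (0, 0, 0)" by simp
  show "line_of (a, b, -1) = vec.span {u, w}"
    unfolding span_cross[OF nz] c by (subst line_of_scale) simp_all
qed

lemma line_of_y:
  fixes a :: complex
  defines "u \<equiv> vector [1, a, 0]" and "w \<equiv> vector [0, 0, 1]"
  shows "cross u w \<noteq> (0, 0, 0)" "line_of (a, -1, 0) = vec.span {u, w}"
proof -
  have c: "cross u w = (1 * a, 1 * - 1, 1 * 0)" by (simp add: cross_def u_def w_def)
  then show nz: "cross u w \<noteq> (0, 0, 0)" by simp
  show "line_of (a, -1, 0) = vec.span {u, w}"
    unfolding span_cross[OF nz] c by (subst line_of_scale) simp_all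
qed

lemma kk_z:
  "komiya_kuribayashi (x *s vector [1, 0, a] + y *s vector [0, 1, b]) =
     (1 + a ^ 4 + 3 * a ^ 2) * x ^ 4 + 2 * a * b * (2 * a ^ 2 + 3) * x ^ 3 * y +
     (6 * a ^ 2 * b ^ 2 + 3 + 3 * a ^ 2 + 3 * b ^ 2) * x ^ 2 * y ^ 2 +
     2 * a * b * (2 * b ^ 2 + 3) * x * y ^ 3 + (1 + b ^ 4 + 3 * b ^ 2) * y ^ 4"
  by (simp add: komiya_kuribayashi_def Let_def eval_nat_numeral algebra_simps)

text \<open>The coefficients 0 and 1 are written out so that the right-hand side matches
  \<open>quartic_eq_square_coeffs\<close>.\<close>

lemma kk_y:
  "komiya_kuribayashi (x *s vector [1, a, 0] + y *s vector [0, 0, 1]) =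
     (1 + a ^ 4 + 3 * a ^ 2) * x ^ 4 + 0 * x ^ 3 * y + 3 * (1 + a ^ 2) * x ^ 2 * y ^ 2 + 0 * x * y ^ 3 + 1 * y ^ 4"
  by (simp add: komiya_kuribayashi_def Let_def eval_nat_numeral algebra_simps)

lemma kk_x:
  "komiya_kuribayashi (x *s vector [0, 1, 0] + y *s vector [0, 0, 1]) =
     1 * x ^ 4 + 0 * x ^ 3 * y + 3 * x ^ 2 * y ^ 2 + 0 * x * y ^ 3 + 1 * y ^ 4"
  by (simp add: komiya_kuribayashi_def Let_def eval_nat_numeral algebra_simps)

lemma square_quadratic:
  fixes \<alpha> \<beta> \<gamma> :: complex
  shows "(\<alpha> * x ^ 2 + \<beta> * x * y + \<gamma> * y ^ 2) ^ 2 = \<alpha> ^ 2 * x ^ 4 + 2 * \<alpha> * \<beta> * x ^ 3 * y +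
     (\<beta> ^ 2 + 2 * \<alpha> * \<gamma>) * x ^ 2 * y ^ 2 + 2 * \<beta> * \<gamma> * x * y ^ 3 + \<gamma> ^ 2 * y ^ 4"
  by (simp add: eval_nat_numeral algebra_simps)

text \<open>On \<open>z = b y\<close> the first and middle coefficients prescribe the square of x^2
  + (3/2) (1 + b^2) y^2; its error in the last coefficient is a quarter of the biquadratic.\<close>

lemma biquadratic_imp_square:
  fixes b :: complex
  assumes "5 * b ^ 4 + 6 * b ^ 2 + 5 = 0"
  shows "1 + b ^ 4 + 3 * b ^ 2 = (3 / 2 * (1 + b ^ 2)) ^ 2"
proof -
  have "(3 / 2 * (1 + b ^ 2)) ^ 2 = 1 + b ^ 4 + 3 * b ^ 2 + (5 * b ^ 4 + 6 * b ^ 2 + 5) / 4"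
    by (simp add: field_simps eval_nat_numeral)
  then show ?thesis using assms by simp
qed

lemma coeffs_imp_square:
  assumes "kk_bitangent_coeffs (a, b, -1)"
  obtains \<alpha> \<beta> \<gamma> :: complex where
    "1 + a ^ 4 + 3 * a ^ 2 = \<alpha> ^ 2" "2 * a * b * (2 * a ^ 2 + 3) = 2 * \<alpha> * \<beta>"
    "6 * a ^ 2 * b ^ 2 + 3 + 3 * a ^ 2 + 3 * b ^ 2 = \<beta> ^ 2 + 2 * \<alpha> * \<gamma>"
    "2 * a * b * (2 * b ^ 2 + 3) = 2 * \<beta> * \<gamma>" "1 + b ^ 4 + 3 * b ^ 2 = \<gamma> ^ 2"
    "\<alpha> \<noteq> 0 \<or> \<gamma> \<noteq> 0"
proof -
  \<comment> \<open>When \<open>a\<close> and \<open>b\<close> are both nonzero,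
    \<open>1 + a ^ 4 + 3 * a ^ 2\<close> is 5 or 5/16, so \<open>\<alpha>\<close> is
    \<open>s\<close> or \<open>s / 4\<close>. The second coefficient then gives
    \<open>\<beta>\<close>, and \<open>\<gamma>\<close> is \<open>\<alpha>\<close> if a^2 = b^2 and
    \<open>- \<alpha>\<close> if a^2 + b^2 = -3.\<close>
  define s where "s = csqrt 5"
  have s: "s ^ 2 = 5" unfolding s_def by (rule power2_csqrt)
  then have s_nz: "s \<noteq> 0" by auto
  have p4: "x ^ 4 = (x ^ 2) ^ 2" for x :: complex by simp
  from assms consider
      "a = 0" "5 * b ^ 4 + 6 * b ^ 2 + 5 = 0" | "b = 0" "5 * a ^ 4 + 6 * a ^ 2 + 5 = 0"
    | "a ^ 2 = 1" "b ^ 2 = 1" | "a ^ 2 = b ^ 2" "1 = - 4 * a ^ 2"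
    | "a ^ 2 = 1" "b ^ 2 = - 4" | "a ^ 2 = - 4" "b ^ 2 = 1"
    unfolding kk_bitangent_coeffs_def prod.case by auto
  then show ?thesis
  proof cases
    case 1
    with biquadratic_imp_square[OF 1(2)] show ?thesis
      by (intro that[of 1 0 "3 / 2 * (1 + b ^ 2)"]) (simp_all add: algebra_simps)
  next
    case 2
    with biquadratic_imp_square[OF 2(2)] show ?thesis
      by (intro that[of "3 / 2 * (1 + a ^ 2)" 0 1]) (simp_all add: algebra_simps)
  next
    case 3
    then show ?thesis
      by (intro that[of s "s * a * b" s]) (simp_all add: p4 power_mult_distrib s s_nz flip: power2_eq_square)
  next
    case 4
    have "a ^ 2 = - (- 4 * a ^ 2) / 4" by simp
    also have "\<dots> = - 1 / 4" unfolding 4(2)[symmetric] ..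
    finally have "a ^ 2 = - 1 / 4" .
    moreover from this have "b ^ 2 = - 1 / 4" unfolding 4(1) .
    ultimately show ?thesis
      by (intro that[of "s / 4" "2 * s * a * b" "s / 4"])
        (simp_all add: p4 power_mult_distrib power_divide s s_nz flip: power2_eq_square)
  next
    case 5
    then show ?thesis
      by (intro that[of s "s * a * b" "- s"]) (simp_all add: p4 power_mult_distrib s s_nz flip: power2_eq_square)
  next
    case 6
    then show ?thesis
      by (intro that[of s "- s * a * b" "- s"]) (simp_all add: p4 power_mult_distrib s s_nz flip: power2_eq_square)
  qed
qed

lemma bitangent_z_iff: "line_of (a, b, -1) \<in> bitangents komiya_kuribayashi \<longleftrightarrow> kk_bitangent_coeffs (a, b, -1)"
proof
  assume "line_of (a, b, -1) \<in> bitangents komiya_kuribayashi"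
  then obtain \<alpha> \<beta> \<gamma> where
    "\<And>x y. komiya_kuribayashi (x *s vector [1, 0, a] + y *s vector [0, 1, b]) = (\<alpha> * x ^ 2 + \<beta> * x * y + \<gamma> * y ^ 2) ^ 2"
    by (rule bitangent_square[OF quartic_form_kk, where u = "vector [1, 0, a]" and w = "vector [0, 1, b]"]) auto
  from square_imp_coeffs[OF quartic_eq_square_coeffs[OF this[unfolded kk_z]]]
  show "kk_bitangent_coeffs (a, b, -1)" .
next
  assume "kk_bitangent_coeffs (a, b, -1)"
  then obtain \<alpha> \<beta> \<gamma> where
    *: "1 + a ^ 4 + 3 * a ^ 2 = \<alpha> ^ 2" "2 * a * b * (2 * a ^ 2 + 3) = 2 * \<alpha> * \<beta>"
    "6 * a ^ 2 * b ^ 2 + 3 + 3 * a ^ 2 + 3 * b ^ 2 = \<beta> ^ 2 + 2 * \<alpha> * \<gamma>"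
    "2 * a * b * (2 * b ^ 2 + 3) = 2 * \<beta> * \<gamma>" "1 + b ^ 4 + 3 * b ^ 2 = \<gamma> ^ 2"
    "\<alpha> \<noteq> 0 \<or> \<gamma> \<noteq> 0" by (rule coeffs_imp_square)
  show "line_of (a, b, -1) \<in> bitangents komiya_kuribayashi"
    unfolding line_of_z
    by (rule bitangentI[OF line_of_z(1)]) (use * in \<open>auto simp only: kk_z square_quadratic\<close>)
qed

lemma bitangent_y_iff: "line_of (a, -1, 0) \<in> bitangents komiya_kuribayashi \<longleftrightarrow> kk_bitangent_coeffs (a, -1, 0)"
proof -
  have iff: "kk_bitangent_coeffs (a, -1, 0) \<longleftrightarrow> 5 * a ^ 4 + 6 * a ^ 2 + 5 = 0"
    by (auto simp: kk_bitangent_coeffs_def)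
  show ?thesis unfolding iff
  proof
    assume "line_of (a, -1, 0) \<in> bitangents komiya_kuribayashi"
    then obtain \<alpha> \<beta> \<gamma> where
      "\<And>x y. komiya_kuribayashi (x *s vector [1, a, 0] + y *s vector [0, 0, 1]) = (\<alpha> * x ^ 2 + \<beta> * x * y + \<gamma> * y ^ 2) ^ 2"
      by (rule bitangent_square[OF quartic_form_kk, where u = "vector [1, a, 0]" and w = "vector [0, 0, 1]"]) auto
    from quartic_eq_square_coeffs[OF this[unfolded kk_y]] show "5 * a ^ 4 + 6 * a ^ 2 + 5 = 0"
      using biquadratic_square[of \<gamma> \<beta> a \<alpha>] by (simp add: mult_ac)
  next
    assume "5 * a ^ 4 + 6 * a ^ 2 + 5 = 0"
    note sq = biquadratic_imp_square[OF this]
    show "line_of (a, -1, 0) \<in> bitangents komiya_kuribayashi"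
      unfolding line_of_y
    proof (rule bitangentI[OF line_of_y(1)])
      show "komiya_kuribayashi (x *s vector [1, a, 0] + y *s vector [0, 0, 1]) =
          (3 / 2 * (1 + a ^ 2) * x ^ 2 + 0 * x * y + 1 * y ^ 2) ^ 2" for x y
        unfolding kk_y square_quadratic sq by simp
    qed simp
  qed
qed

lemma bitangent_x: "line_of (1, 0, 0) \<notin> bitangents komiya_kuribayashi"
proof
  assume "line_of (1, 0, 0) \<in> bitangents komiya_kuribayashi"
  then obtain \<alpha> \<beta> \<gamma> where
    "\<And>x y. komiya_kuribayashi (x *s vector [0, 1, 0] + y *s vector [0, 0, 1]) = (\<alpha> * x ^ 2 + \<beta> * x * y + \<gamma> * y ^ 2) ^ 2"
    by (rule bitangent_square[OF quartic_form_kk, where u = "vector [0, 1, 0]" and w = "vector [0, 0, 1]"]) auto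
  from quartic_eq_square_coeffs[OF this[unfolded kk_x]] show False
    using biquadratic_square[of \<alpha> \<beta> 0 \<gamma>] by simp
qed

lemma kk_bitangent_coeffs_scale:
  assumes "d \<noteq> 0"
  shows "kk_bitangent_coeffs (d * p, d * q, d * r) \<longleftrightarrow> kk_bitangent_coeffs (p, q, r)"
proof -
  have *: "5 * (d * x) ^ 4 + 6 * (d * x) ^ 2 * (d * y) ^ 2 + 5 * (d * y) ^ 4 =
      d ^ 4 * (5 * x ^ 4 + 6 * x ^ 2 * y ^ 2 + 5 * y ^ 4)" for x y
    by (simp add: eval_nat_numeral algebra_simps)
  have cancel: "d ^ 2 * u = d ^ 2 * v \<longleftrightarrow> u = v" for u v using assms by simp
  have "(d * x) ^ 2 = (d * y) ^ 2 \<longleftrightarrow> x ^ 2 = y ^ 2" "(d * x) ^ 2 = - 4 * (d * y) ^ 2 \<longleftrightarrow> x ^ 2 = - 4 * y ^ 2" for x y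
    by (simp_all only: power_mult_distrib mult.left_commute[of "- 4"] cancel)
  with * assms show ?thesis by (simp add: kk_bitangent_coeffs_def)
qed

text \<open>Scaling by the last nonzero coordinate moves \<open>l\<close> into one of the three
  charts.\<close>

lemma bitangent_line_iff:
  assumes "l \<noteq> (0, 0, 0)"
  shows "line_of l \<in> bitangents komiya_kuribayashi \<longleftrightarrow> kk_bitangent_coeffs l"
proof -
  obtain p q r where l: "l = (p, q, r)" by (cases l)
  consider "r \<noteq> 0" | "r = 0" "q \<noteq> 0" | "r = 0" "q = 0" "p \<noteq> 0" using assms l by auto
  then show ?thesis
  proof cases
    case 1
    then have l': "l = (- r * (- p / r), - r * (- q / r), - r * -1)" by (simp add: l)
    have "line_of l = line_of (- p / r, - q / r, -1)" "kk_bitangent_coeffs l \<longleftrightarrow> kk_bitangent_coeffs (- p / r, - q / r, -1)"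
      by (subst l', rule line_of_scale kk_bitangent_coeffs_scale, use 1 in simp)+
    then show ?thesis by (simp only: bitangent_z_iff)
  next
    case 2
    then have l': "l = (- q * (- p / q), - q * -1, - q * 0)" by (simp add: l)
    have "line_of l = line_of (- p / q, -1, 0)" "kk_bitangent_coeffs l \<longleftrightarrow> kk_bitangent_coeffs (- p / q, -1, 0)"
      by (subst l', rule line_of_scale kk_bitangent_coeffs_scale, use 2 in simp)+
    then show ?thesis by (simp only: bitangent_y_iff)
  next
    case 3
    then have "l = (p * 1, p * 0, p * 0)" by (simp add: l)
    moreover have "\<not> kk_bitangent_coeffs (1, 0, 0)" by (simp add: kk_bitangent_coeffs_def)
    ultimately show ?thesis
      using 3 line_of_scale[of p 1 0 0] kk_bitangent_coeffs_scale[of p 1 0 0] bitangent_x by simp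
  qed
qed

section \<open>The 28 coefficient vectors\<close>

abbreviation sqrt5 :: complex where "sqrt5 \<equiv> complex_of_real (sqrt 5)"

lemma sqrt5_sq: "sqrt5 ^ 2 = 5"
  by (simp flip: of_real_power)

text \<open>Taken at \<open>\<i>\<close> and \<open>sqrt5\<close> this gives the lines, at 34 and 19
  their residues in the same order. The last nonzero entries -2 and \<open>- S\<close> clear
  denominators. The last three blocks are the lines through the coordinate points.\<close>

definition kk_coeffs :: "'a::comm_ring_1 \<Rightarrow> 'a \<Rightarrow> ('a \<times> 'a \<times> 'a) list" where
  "kk_coeffs I S =
     [(a, b, -1). a \<leftarrow> [1, -1], b \<leftarrow> [1, -1]] @
     [(a, 2 * b * I, -1). a \<leftarrow> [1, -1], b \<leftarrow> [1, -1]] @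
     [(2 * a * I, b, -1). a \<leftarrow> [1, -1], b \<leftarrow> [1, -1]] @
     [(a * I, b * I, -2). a \<leftarrow> [1, -1], b \<leftarrow> [1, -1]] @
     [(0, a + 2 * b * I, - S). a \<leftarrow> [1, -1], b \<leftarrow> [1, -1]] @
     [(a + 2 * b * I, 0, - S). a \<leftarrow> [1, -1], b \<leftarrow> [1, -1]] @
     [(a + 2 * b * I, - S, 0). a \<leftarrow> [1, -1], b \<leftarrow> [1, -1]]"

lemma quartic_roots:
  fixes x :: complex
  assumes "x ^ 4 + 6 * x ^ 2 + 25 = 0"
  shows "\<exists>a\<in>{1, -1}. \<exists>b\<in>{1, -1}. x = a + 2 * b * \<i>"
proof -
  \<comment> \<open>The roots are the square roots of -3 + 4i and -3 - 4i; the trailing terms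
    contain the factor \<open>\<i> ^ 2 + 1\<close>, which is zero.\<close>
  have "x ^ 4 + 6 * x ^ 2 + 25 =
      (x - (1 + 2 * 1 * \<i>)) * (x - (1 + 2 * -1 * \<i>)) * (x - (-1 + 2 * 1 * \<i>)) * (x - (-1 + 2 * -1 * \<i>))
      - 8 * (\<i> ^ 2 + 1) * x ^ 2 + (16 * \<i> ^ 2 - 24) * (\<i> ^ 2 + 1) * - 1"
    by (simp add: algebra_simps eval_nat_numeral)
  with assms have "(x - (1 + 2 * 1 * \<i>)) * (x - (1 + 2 * -1 * \<i>)) * (x - (-1 + 2 * 1 * \<i>)) * (x - (-1 + 2 * -1 * \<i>)) = 0"
    by (simp only: power2_i) simp
  then show ?thesis by (simp only: mult_eq_0_iff right_minus_eq bex_simps) blast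
qed

text \<open>Dehomogenising at \<open>r = - sqrt5\<close> turns the form into 5 (x^4 + 6 x^2 + 25),
  whose roots are Gaussian integers.\<close>

lemma biquadratic_form_zero:
  assumes "5 * q ^ 4 + 6 * q ^ 2 * r ^ 2 + 5 * r ^ 4 = 0" "(q, r) \<noteq> (0, 0)"
  obtains d a b where "d \<noteq> 0" "a \<in> {1, -1}" "b \<in> {1, -1}" "q = d * (a + 2 * b * \<i>)" "r = d * - sqrt5"
proof -
  have s: "sqrt5 \<noteq> 0" "sqrt5 ^ 2 = 5" by (simp, rule sqrt5_sq)
  have r: "r \<noteq> 0" using assms by auto
  define d where "d = - r / sqrt5"
  define x where "x = q / d"
  have d: "d \<noteq> 0" using r s by (simp add: d_def)
  have q: "q = d * x" using d by (simp add: x_def)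
  have r': "r = d * - sqrt5" using s by (simp add: d_def)
  have "5 * q ^ 4 + 6 * q ^ 2 * r ^ 2 + 5 * r ^ 4 =
      d ^ 4 * (5 * x ^ 4 + 6 * x ^ 2 * (sqrt5 ^ 2) + 5 * (sqrt5 ^ 2) ^ 2)"
    unfolding q r' by (simp add: eval_nat_numeral algebra_simps)
  also have "\<dots> = d ^ 4 * (5 * (x ^ 4 + 6 * x ^ 2 + 25))" unfolding s(2) by simp
  finally have "d ^ 4 * (5 * (x ^ 4 + 6 * x ^ 2 + 25)) = 0" unfolding assms(1) ..
  then have "x ^ 4 + 6 * x ^ 2 + 25 = 0"
    using d by (simp only: mult_eq_0_iff power_eq_0_iff) simp
  then show ?thesis using quartic_roots that[OF d] q r' by blast
qed

lemma biquadratic_form_root: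
  assumes "a \<in> {1, -1}" "b \<in> {1, -1}"
  shows "5 * (a + 2 * b * \<i>) ^ 4 + 6 * (a + 2 * b * \<i>) ^ 2 * (- sqrt5) ^ 2 + 5 * (- sqrt5) ^ 4 = 0"
proof -
  \<comment> \<open>Since a^2 = b^2 = 1, the square of a + 2bi is -3 + 4abi.\<close>
  have "((a + 2 * b * \<i>) ^ 2 + 3) ^ 2 = - 16" using assms
    by (auto simp: power2_eq_square algebra_simps)
  moreover have "5 * x ^ 4 + 6 * x ^ 2 * (- sqrt5) ^ 2 + 5 * (- sqrt5) ^ 4 = 5 * ((x ^ 2 + 3) ^ 2 + 16)" for x :: complex
  proof -
    have "(- sqrt5) ^ 2 = 5" using sqrt5_sq by simp
    moreover have "(- sqrt5) ^ 4 = (sqrt5 ^ 2) ^ 2" by (simp only: power_mult[symmetric]) simp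
    ultimately show ?thesis unfolding sqrt5_sq by (simp add: eval_nat_numeral algebra_simps)
  qed
  ultimately show ?thesis by simp
qed

lemma set_kk_coeffs:
  "set (kk_coeffs I S) = (\<Union>a\<in>{1, -1}. \<Union>b\<in>{1, -1}.
     {(a, b, -1), (a, 2 * b * I, -1), (2 * a * I, b, -1), (a * I, b * I, -2),
      (0, a + 2 * b * I, - S), (a + 2 * b * I, 0, - S), (a + 2 * b * I, - S, 0)})"
  unfolding kk_coeffs_def by auto

lemma kk_coeffs_mem:
  assumes "a \<in> {1, -1}" "b \<in> {1, -1}"
  shows "(a, b, -1) \<in> set (kk_coeffs I S)" "(a, 2 * b * I, -1) \<in> set (kk_coeffs I S)"
    "(2 * a * I, b, -1) \<in> set (kk_coeffs I S)" "(a * I, b * I, -2) \<in> set (kk_coeffs I S)"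
    "(0, a + 2 * b * I, - S) \<in> set (kk_coeffs I S)" "(a + 2 * b * I, 0, - S) \<in> set (kk_coeffs I S)"
    "(a + 2 * b * I, - S, 0) \<in> set (kk_coeffs I S)"
  unfolding set_kk_coeffs using assms by blast+

lemma kk_coeffs_bitangent:
  assumes "l \<in> set (kk_coeffs \<i> sqrt5)"
  shows "l \<noteq> (0, 0, 0)" "kk_bitangent_coeffs l"
proof -
  have s: "sqrt5 \<noteq> 0" by simp
  from assms obtain a b where ab: "a \<in> {1, -1}" "b \<in> {1, -1}" and
    l: "l \<in> {(a, b, -1), (a, 2 * b * \<i>, -1), (2 * a * \<i>, b, -1), (a * \<i>, b * \<i>, -2),
      (0, a + 2 * b * \<i>, - sqrt5), (a + 2 * b * \<i>, 0, - sqrt5), (a + 2 * b * \<i>, - sqrt5, 0)}"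
    unfolding set_kk_coeffs by blast
  show "l \<noteq> (0, 0, 0)" using l s by auto
  have "a ^ 2 = 1" "b ^ 2 = 1" using ab by auto
  note sq = this
  from l consider "l \<in> {(a, b, -1), (a, 2 * b * \<i>, -1), (2 * a * \<i>, b, -1), (a * \<i>, b * \<i>, -2)}"
    | "l \<in> {(0, a + 2 * b * \<i>, - sqrt5), (a + 2 * b * \<i>, 0, - sqrt5), (a + 2 * b * \<i>, - sqrt5, 0)}"
    by blast
  then show "kk_bitangent_coeffs l"
  proof cases
    case 1
    then show ?thesis by (elim insertE emptyE) (simp_all add: kk_bitangent_coeffs_def power_mult_distrib sq)
  next
    case 2
    then show ?thesis unfolding kk_bitangent_coeffs_def
      by (elim insertE emptyE) (simp_all only: prod.case biquadratic_form_root[OF ab] simp_thms)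
  qed
qed

lemma bitangent_kk_coeffs:
  assumes nz: "l \<noteq> (0, 0, 0)" and l: "kk_bitangent_coeffs l"
  shows "line_of l \<in> line_of ` set (kk_coeffs \<i> sqrt5)"
proof -
  obtain p q r where pqr: "l = (p, q, r)" by (cases l)
  have scale: ?thesis if "d \<noteq> 0" "(a, b, c) \<in> set (kk_coeffs \<i> sqrt5)" "p = d * a" "q = d * b" "r = d * c" for a b c d
    unfolding pqr that(3-5) line_of_scale[OF that(1)] using that(2) by (rule imageI)
  have sgn: "\<exists>a\<in>{1, -1}. x = d * (a * c)" if "x ^ 2 = (d * c) ^ 2" for x c d :: complex
    using that by (auto simp: power2_eq_iff)
  from l[unfolded pqr kk_bitangent_coeffs_def prod.case]
  consider "p = 0" "5 * q ^ 4 + 6 * q ^ 2 * r ^ 2 + 5 * r ^ 4 = 0"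
    | "q = 0" "5 * p ^ 4 + 6 * p ^ 2 * r ^ 2 + 5 * r ^ 4 = 0"
    | "r = 0" "5 * p ^ 4 + 6 * p ^ 2 * q ^ 2 + 5 * q ^ 4 = 0"
    | "p ^ 2 = q ^ 2" "q ^ 2 = r ^ 2"
    | "p ^ 2 = q ^ 2" "r ^ 2 = - 4 * p ^ 2"
    | "p ^ 2 = r ^ 2" "q ^ 2 = - 4 * p ^ 2"
    | "q ^ 2 = r ^ 2" "p ^ 2 = - 4 * q ^ 2" by blast
  then show ?thesis
  proof cases
    case 1
    with nz pqr have "(q, r) \<noteq> (0, 0)" by simp
    from biquadratic_form_zero[OF 1(2) this] obtain d a b where
      *: "d \<noteq> 0" "a \<in> {1, -1}" "b \<in> {1, -1}" "q = d * (a + 2 * b * \<i>)" "r = d * - sqrt5" .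
    have "p = d * 0" using 1 by simp
    with * show ?thesis by (intro scale[OF *(1) kk_coeffs_mem(5)[OF *(2,3)]])
  next
    case 2
    with nz pqr have "(p, r) \<noteq> (0, 0)" by simp
    from biquadratic_form_zero[OF 2(2) this] obtain d a b where
      *: "d \<noteq> 0" "a \<in> {1, -1}" "b \<in> {1, -1}" "p = d * (a + 2 * b * \<i>)" "r = d * - sqrt5" .
    have "q = d * 0" using 2 by simp
    with * show ?thesis by (intro scale[OF *(1) kk_coeffs_mem(6)[OF *(2,3)]])
  next
    case 3
    with nz pqr have "(p, q) \<noteq> (0, 0)" by simp
    from biquadratic_form_zero[OF 3(2) this] obtain d a b where
      *: "d \<noteq> 0" "a \<in> {1, -1}" "b \<in> {1, -1}" "p = d * (a + 2 * b * \<i>)" "q = d * - sqrt5" .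
    have "r = d * 0" using 3 by simp
    with * show ?thesis by (intro scale[OF *(1) kk_coeffs_mem(7)[OF *(2,3)]])
  next
    case 4
    then have "- r \<noteq> 0" using nz pqr by auto
    have "p ^ 2 = (- r * 1) ^ 2" "q ^ 2 = (- r * 1) ^ 2"
      using 4 by (simp_all add: power_mult_distrib power_divide)
    then obtain a b where ab: "a \<in> {1, -1}" "b \<in> {1, -1}" "p = - r * (a * 1)" "q = - r * (b * 1)"
      using sgn by meson
    show ?thesis
      by (rule scale[OF \<open>- r \<noteq> 0\<close> kk_coeffs_mem(1)[OF ab(1,2)]]) (simp_all add: ab(3,4))
  next
    case 5
    then have "- r / 2 \<noteq> 0" using nz pqr by auto
    have "p ^ 2 = (- r / 2 * \<i>) ^ 2" "q ^ 2 = (- r / 2 * \<i>) ^ 2"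
      using 5 by (simp_all add: power_mult_distrib power_divide)
    then obtain a b where ab: "a \<in> {1, -1}" "b \<in> {1, -1}" "p = - r / 2 * (a * \<i>)" "q = - r / 2 * (b * \<i>)"
      using sgn by meson
    show ?thesis
      by (rule scale[OF \<open>- r / 2 \<noteq> 0\<close> kk_coeffs_mem(4)[OF ab(1,2)]]) (simp_all add: ab(3,4))
  next
    case 6
    then have "- r \<noteq> 0" using nz pqr by auto
    have "p ^ 2 = (- r * 1) ^ 2" "q ^ 2 = (- r * (2 * \<i>)) ^ 2"
      using 6 by (simp_all add: power_mult_distrib power_divide)
    then obtain a b where ab: "a \<in> {1, -1}" "b \<in> {1, -1}" "p = - r * (a * 1)" "q = - r * (b * (2 * \<i>))"
      using sgn by meson
    show ?thesis
      by (rule scale[OF \<open>- r \<noteq> 0\<close> kk_coeffs_mem(2)[OF ab(1,2)]]) (simp_all add: ab(3,4))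
  next
    case 7
    then have "- r \<noteq> 0" using nz pqr by auto
    have "p ^ 2 = (- r * (2 * \<i>)) ^ 2" "q ^ 2 = (- r * 1) ^ 2"
      using 7 by (simp_all add: power_mult_distrib power_divide)
    then obtain a b where ab: "a \<in> {1, -1}" "b \<in> {1, -1}" "p = - r * (a * (2 * \<i>))" "q = - r * (b * 1)"
      using sgn by meson
    show ?thesis
      by (rule scale[OF \<open>- r \<noteq> 0\<close> kk_coeffs_mem(3)[OF ab(1,2)]]) (simp_all add: ab(3,4))
  qed
qed

lemma bitangents_kk: "bitangents komiya_kuribayashi = line_of ` set (kk_coeffs \<i> sqrt5)"
proof (intro equalityI subsetI)
  fix L assume L: "L \<in> bitangents komiya_kuribayashi"
  then have "L \<in> proj_lines" by (auto simp: bitangents_def line_cuts_def)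
  then obtain p q where "L = vec.span {p, q}" "cross p q \<noteq> (0, 0, 0)" by (rule proj_lineE)
  then have "L = line_of (cross p q)" by (simp add: span_cross)
  with L \<open>cross p q \<noteq> (0, 0, 0)\<close> show "L \<in> line_of ` set (kk_coeffs \<i> sqrt5)"
    using bitangent_line_iff bitangent_kk_coeffs by blast
next
  fix L assume "L \<in> line_of ` set (kk_coeffs \<i> sqrt5)"
  then show "L \<in> bitangents komiya_kuribayashi"
    using kk_coeffs_bitangent bitangent_line_iff by blast
qed

section \<open>Concurrent bitangents\<close>

fun det3 :: "'a::comm_ring_1 \<times> 'a \<times> 'a \<Rightarrow> 'a \<times> 'a \<times> 'a \<Rightarrow> 'a \<times> 'a \<times> 'a \<Rightarrow> 'a" where
  "det3 (a, b, c) (d, e, f) (g, h, i) =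
     a * (e * i - f * h) - b * (d * i - f * g) + c * (d * h - e * g)"

text \<open>
  Reduction of \<open>\<int>[\<i>, \<surd>5]\<close> modulo 89, with \<open>34\<^sup>2 \<equiv> -1\<close> and \<open>19\<^sup>2 \<equiv> 5\<close>. Among the primes modulo which
  both \<open>-1\<close> and \<open>5\<close> are squares, 89 is the least for which no nonzero determinant
  of three of the 28 coefficient vectors vanishes.
\<close>

definition reduces :: "complex \<Rightarrow> int \<Rightarrow> bool" where
  "reduces z m \<longleftrightarrow> (\<exists>a b c d :: int.
     z = of_int a + of_int b * \<i> + (of_int c + of_int d * \<i>) * sqrt5 \<and> (a + 34 * b + 19 * (c + 34 * d)) mod 89 = m mod 89)"

lemma reduces_add: "reduces z m \<Longrightarrow> reduces w n \<Longrightarrow> reduces (z + w) (m + n)"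
proof -
  assume "reduces z m" "reduces w n"
  then obtain a b c d a' b' c' d' :: int where
    *: "z = of_int a + of_int b * \<i> + (of_int c + of_int d * \<i>) * sqrt5"
      "w = of_int a' + of_int b' * \<i> + (of_int c' + of_int d' * \<i>) * sqrt5"
      "(a + 34 * b + 19 * (c + 34 * d)) mod 89 = m mod 89" "(a' + 34 * b' + 19 * (c' + 34 * d')) mod 89 = n mod 89"
    unfolding reduces_def by blast
  show ?thesis unfolding reduces_def
    by (rule exI[of _ "a + a'"], rule exI[of _ "b + b'"], rule exI[of _ "c + c'"], rule exI[of _ "d + d'"])
      (use *(1,2) mod_add_cong[OF *(3,4)] in \<open>simp add: algebra_simps\<close>)
qed

lemma reduces_minus: "reduces z m \<Longrightarrow> reduces (- z) (- m)"
proof -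
  assume "reduces z m"
  then obtain a b c d :: int where
    *: "z = of_int a + of_int b * \<i> + (of_int c + of_int d * \<i>) * sqrt5"
      "(a + 34 * b + 19 * (c + 34 * d)) mod 89 = m mod 89"
    unfolding reduces_def by blast
  from *(2) have "(- (a + 34 * b + 19 * (c + 34 * d))) mod 89 = (- m) mod 89" by (rule mod_minus_cong)
  with * show ?thesis unfolding reduces_def
    by (intro exI[of _ "- a"] exI[of _ "- b"] exI[of _ "- c"] exI[of _ "- d"]) (simp add: algebra_simps)
qed

lemma reduces_diff: "reduces z m \<Longrightarrow> reduces w n \<Longrightarrow> reduces (z - w) (m - n)"
  using reduces_add[of z m "- w" "- n"] reduces_minus by simp

lemma reduces_mult: "reduces z m \<Longrightarrow> reduces w n \<Longrightarrow> reduces (z * w) (m * n)"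
proof -
  assume "reduces z m" "reduces w n"
  then obtain a b c d a' b' c' d' :: int where
    *: "z = of_int a + of_int b * \<i> + (of_int c + of_int d * \<i>) * sqrt5"
      "w = of_int a' + of_int b' * \<i> + (of_int c' + of_int d' * \<i>) * sqrt5"
      "(a + 34 * b + 19 * (c + 34 * d)) mod 89 = m mod 89" "(a' + 34 * b' + 19 * (c' + 34 * d')) mod 89 = n mod 89"
    unfolding reduces_def by blast
  \<comment> \<open>Coefficients of the product in the basis 1, i, sqrt 5, i sqrt 5. The correction
    terms below carry the vanishing factors \<open>\<i> ^ 2 + 1\<close> and
    \<open>sqrt5 ^ 2 - 5\<close>.\<close>
  define A where "A = a * a' - b * b' + 5 * (c * c' - d * d')"
  define B where "B = a * b' + b * a' + 5 * (c * d' + d * c')"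
  define C where "C = a * c' - b * d' + c * a' - d * b'"
  define D where "D = a * d' + b * c' + c * b' + d * a'"
  have "z * w = of_int A + of_int B * \<i> + (of_int C + of_int D * \<i>) * sqrt5 +
      (\<i> ^ 2 + 1) * ((of_int b + of_int d * sqrt5) * (of_int b' + of_int d' * sqrt5)) +
      (sqrt5 ^ 2 - 5) * (of_int c * of_int c' + (of_int c * of_int d' + of_int d * of_int c') * \<i> - of_int d * of_int d')"
    unfolding *(1,2) A_def B_def C_def D_def by (simp add: algebra_simps power2_eq_square)
  then have zw: "z * w = of_int A + of_int B * \<i> + (of_int C + of_int D * \<i>) * sqrt5"
    by (simp add: sqrt5_sq del: of_real_power)
  \<comment> \<open>The multiple of 89 comes from 34^2 + 1 = 13 * 89 and 19^2 - 5 = 4 * 89.\<close>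
  have "(a + 34 * b + 19 * (c + 34 * d)) * (a' + 34 * b' + 19 * (c' + 34 * d')) =
      A + 34 * B + 19 * (C + 34 * D) + 89 * (13 * (b + 19 * d) * (b' + 19 * d') + 4 * (c * c' + 34 * (c * d' + d * c') - d * d'))"
    unfolding A_def B_def C_def D_def by (simp add: algebra_simps)
  then have "(A + 34 * B + 19 * (C + 34 * D)) mod 89 =
      ((a + 34 * b + 19 * (c + 34 * d)) * (a' + 34 * b' + 19 * (c' + 34 * d'))) mod 89"
    by (simp only: mod_mult_self2)
  from trans[OF this mod_mult_cong[OF *(3,4)]] zw show ?thesis
    unfolding reduces_def by blast
qed

lemma reduces_of_int: "reduces (of_int a) a"
  unfolding reduces_def by (rule exI[of _ a], rule exI[of _ 0], rule exI[of _ 0], rule exI[of _ 0]) simp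

lemma reduces_i: "reduces \<i> 34"
  unfolding reduces_def by (rule exI[of _ 0], rule exI[of _ 1], rule exI[of _ 0], rule exI[of _ 0]) simp

lemma reduces_sqrt5: "reduces sqrt5 19"
  unfolding reduces_def by (rule exI[of _ 0], rule exI[of _ 0], rule exI[of _ 1], rule exI[of _ 0]) simp

text \<open>In a^2 = 5 c^2 the exponent of 5 is even on the left and odd on the right.\<close>

lemma int_sqrt5_independent:
  fixes a c :: int
  assumes "real_of_int a + real_of_int c * sqrt 5 = 0"
  shows "a = 0 \<and> c = 0"
proof -
  have "c = 0"
  proof (rule ccontr)
    assume c: "c \<noteq> 0"
    have "real_of_int a = - real_of_int c * sqrt 5" using assms by simp
    then have "real_of_int a ^ 2 = real_of_int c ^ 2 * sqrt 5 ^ 2"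
      by (simp add: power_mult_distrib)
    then have "real_of_int (a ^ 2) = real_of_int (5 * c ^ 2)" by simp
    then have eq: "a ^ 2 = 5 * c ^ 2" by (simp only: of_int_eq_iff)
    have "a \<noteq> 0" using eq c by auto
    have 5: "prime_elem (5 :: int)" by (intro prime_imp_prime_elem) simp
    have "2 * multiplicity 5 a = multiplicity 5 (5 * c ^ 2)"
      using \<open>a \<noteq> 0\<close> by (simp add: prime_elem_multiplicity_power_distrib[OF 5] flip: eq)
    also have "\<dots> = Suc (2 * multiplicity 5 c)"
      using c by (simp add: prime_elem_multiplicity_mult_distrib[OF 5] prime_elem_multiplicity_power_distrib[OF 5])
    finally show False by presburger
  qed
  with assms show ?thesis by simp
qed

text \<open>\<open>reduces\<close> accepts any representation of a number in 1, i, sqrt 5, i sqrt 5.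
  Independence over the integers makes that of 0 unique, and 0 is the only value whose residue has
  to be well defined.\<close>

lemma reduces_0: "reduces 0 m \<Longrightarrow> m mod 89 = 0"
proof -
  assume "reduces 0 m"
  then obtain a b c d :: int where
    *: "0 = of_int a + of_int b * \<i> + (of_int c + of_int d * \<i>) * sqrt5"
      "(a + 34 * b + 19 * (c + 34 * d)) mod 89 = m mod 89"
    unfolding reduces_def by blast
  have "real_of_int a + real_of_int c * sqrt 5 = 0" "real_of_int b + real_of_int d * sqrt 5 = 0"
    using arg_cong[OF *(1), of Re] arg_cong[OF *(1), of Im] by simp_all
  then have "a = 0" "b = 0" "c = 0" "d = 0" by (auto dest: int_sqrt5_independent)
  with *(2) show ?thesis by simp
qed

fun reduces3 :: "complex \<times> complex \<times> complex \<Rightarrow> int \<times> int \<times> int \<Rightarrow> bool" where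
  "reduces3 (a, b, c) (k, m, n) \<longleftrightarrow> reduces a k \<and> reduces b m \<and> reduces c n"

lemma reduces_det3: "reduces3 x x' \<Longrightarrow> reduces3 y y' \<Longrightarrow> reduces3 z z' \<Longrightarrow> reduces (det3 x y z) (det3 x' y' z')"
  by (cases x; cases x'; cases y; cases y'; cases z; cases z')
    (simp add: reduces_add reduces_diff reduces_mult)

lemma reduces3_kk_coeffs: "list_all2 reduces3 (kk_coeffs \<i> sqrt5) (kk_coeffs 34 19)"
proof -
  have n: "reduces 0 0" "reduces 1 1" "reduces (- 1) (- 1)" "reduces 2 2" "reduces (- 2) (- 2)"
    using reduces_of_int[of 0] reduces_of_int[of 1] reduces_of_int[of "- 1"] reduces_of_int[of 2]
      reduces_of_int[of "- 2"] by simp_all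
  show ?thesis
    unfolding kk_coeffs_def list.map concat.simps append.simps list_all2_Cons list_all2_Nil reduces3.simps
    by (intro conjI refl n reduces_i reduces_sqrt5 reduces_add reduces_minus reduces_mult)
qed

text \<open>
  The bitangents through \<open>(1, 0, 1)\<close>, \<open>(0, 1, 1)\<close>, \<open>(1, -1, 0)\<close>, \<open>(1, 1, 0)\<close>, \<open>(0, 1, -1)\<close>,
  \<open>(1, 0, -1)\<close> and the three coordinate points, as positions in \<^const>\<open>kk_coeffs\<close>.
\<close>

definition quads :: "nat list list" where
  "quads = [[0, 1, 4, 5], [0, 2, 8, 10], [0, 3, 12, 15], [1, 2, 13, 14], [1, 3, 9, 11],
     [2, 3, 6, 7], [16, 17, 18, 19], [20, 21, 22, 23], [24, 25, 26, 27]]"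

text \<open>Increasing triples are enough, because concurrency does not depend on the order of the
  lines.\<close>

lemma det3_mod_89:
  "\<forall>k<28. \<forall>j<k. \<forall>i<j.
     det3 (kk_coeffs 34 (19::int) ! i) (kk_coeffs 34 19 ! j) (kk_coeffs 34 19 ! k) mod 89 = 0 \<longrightarrow>
     (\<exists>Q\<in>set quads. {i, j, k} \<subseteq> set Q)"
proof -
  define c where "c = kk_coeffs 34 (19::int)"
  \<comment> \<open>Pairing each vector with its position spares the evaluation an
    \<open>nth\<close> lookup for every triple.\<close>
  have "let L = List.enumerate 0 (kk_coeffs 34 (19::int)) in
    list_all (\<lambda>(i, x). list_all (\<lambda>(j, y). list_all (\<lambda>(k, z).
      if det3 x y z mod 89 = 0 then list_ex (\<lambda>Q. i \<in> set Q \<and> j \<in> set Q \<and> k \<in> set Q) quads else True)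
     (filter (\<lambda>(k, z). j < k) L)) (filter (\<lambda>(j, y). i < j) L)) L"
    by code_simp
  then have A: "\<forall>a\<in>set (List.enumerate 0 c). case a of (i, x) \<Rightarrow>
      \<forall>b\<in>set (filter (\<lambda>(j, y). i < j) (List.enumerate 0 c)). case b of (j, y) \<Rightarrow>
      \<forall>d\<in>set (filter (\<lambda>(k, z). j < k) (List.enumerate 0 c)). case d of (k, z) \<Rightarrow>
      if det3 x y z mod 89 = 0 then \<exists>Q\<in>set quads. i \<in> set Q \<and> j \<in> set Q \<and> k \<in> set Q else True"
    by (simp only: list_all_iff list_ex_iff Let_def c_def)
  have *: "det3 (c ! i) (c ! j) (c ! k) mod 89 = 0 \<longrightarrow> (\<exists>Q\<in>set quads. i \<in> set Q \<and> j \<in> set Q \<and> k \<in> set Q)"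
    if "i < j" "j < k" "k < length c" for i j k
  proof -
    have m: "(i, c ! i) \<in> set (List.enumerate 0 c)" "(j, c ! j) \<in> set (filter (\<lambda>(j, y). i < j) (List.enumerate 0 c))"
      "(k, c ! k) \<in> set (filter (\<lambda>(k, z). j < k) (List.enumerate 0 c))"
      using that by (auto simp: in_set_enumerate_eq)
    show ?thesis
      using bspec[OF bspec[OF bspec[OF A m(1), unfolded prod.case] m(2), unfolded prod.case] m(3), unfolded prod.case]
      by (simp split: if_splits)
  qed
  have "length c = 28" by (simp add: c_def kk_coeffs_def)
  with * show ?thesis by (auto simp: c_def)
qed

section \<open>Incidences among the 28 bitangents\<close>

definition kk_line :: "nat \<Rightarrow> (complex ^ 3) set" where
  "kk_line i = line_of (kk_coeffs \<i> sqrt5 ! i)"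

lemma length_kk_coeffs: "length (kk_coeffs I S) = 28"
  by (simp add: kk_coeffs_def)

lemma bitangents_kk_line: "bitangents komiya_kuribayashi = kk_line ` {..<28}"
proof -
  have "set (kk_coeffs \<i> sqrt5) = (!) (kk_coeffs \<i> sqrt5) ` {..<28}"
    using nth_image[of 28 "kk_coeffs \<i> sqrt5"] by (simp add: length_kk_coeffs lessThan_atLeast0)
  then show ?thesis by (simp add: bitangents_kk kk_line_def image_image)
qed

lemma kk_line_proj_line: "i < 28 \<Longrightarrow> kk_line i \<in> proj_lines"
  unfolding kk_line_def
  by (intro line_of_proj_line kk_coeffs_bitangent(1) nth_mem) (simp add: length_kk_coeffs)

lemma concurrent_imp_quad:
  assumes "i < 28" "j < 28" "k < 28" "i \<noteq> j" "i \<noteq> k" "j \<noteq> k"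
    and P: "P \<in> proj_points" "P \<subseteq> kk_line i" "P \<subseteq> kk_line j" "P \<subseteq> kk_line k"
  shows "\<exists>Q\<in>set quads. {i, j, k} \<subseteq> set Q"
proof -
  obtain v where v: "P = vec.span {v}" "v \<noteq> 0" using P(1) by (rule proj_pointE)
  then have "v \<in> P" by (simp add: vec.span_base)
  have det: "det3 x y z = 0" if "v \<in> line_of x" "v \<in> line_of y" "v \<in> line_of z" for x y z
    using that det_eq_0_of_common_point[OF v(2)] by (cases x; cases y; cases z) simp
  have ordered: "\<exists>Q\<in>set quads. {i, j, k} \<subseteq> set Q"
    if "i < j" "j < k" "k < 28" "v \<in> kk_line i" "v \<in> kk_line j" "v \<in> kk_line k" for i j k
  proof -
    have "reduces3 (kk_coeffs \<i> sqrt5 ! m) (kk_coeffs 34 19 ! m)" if "m < 28" for m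
      using reduces3_kk_coeffs that by (simp add: list_all2_conv_all_nth length_kk_coeffs)
    then have "reduces 0 (det3 (kk_coeffs 34 19 ! i) (kk_coeffs 34 19 ! j) (kk_coeffs 34 19 ! k))"
      using reduces_det3[of "kk_coeffs \<i> sqrt5 ! i" _ "kk_coeffs \<i> sqrt5 ! j" _ "kk_coeffs \<i> sqrt5 ! k"]
        det[OF that(4-6)[unfolded kk_line_def]] that(1-3) by simp
    then show ?thesis using reduces_0 det3_mod_89 that by blast
  qed
  have "v \<in> kk_line i" "v \<in> kk_line j" "v \<in> kk_line k" using \<open>v \<in> P\<close> P by auto
  moreover consider "i < j" "j < k" | "i < k" "k < j" | "j < i" "i < k" | "j < k" "k < i"
    | "k < i" "i < j" | "k < j" "j < i" using assms(4-6) by linarith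
  ultimately show ?thesis using assms(1-3)
    by cases (use ordered[of i j k] ordered[of i k j] ordered[of j i k] ordered[of j k i]
      ordered[of k i j] ordered[of k j i] in \<open>auto\<close>)
qed

text \<open>Supplies, for two lines suspected to be equal, a third line that cannot be concurrent
  with them.\<close>

lemma not_in_quad: "\<forall>i<28. \<forall>j<i. \<exists>k<28. k \<noteq> i \<and> k \<noteq> j \<and> (\<forall>Q\<in>set quads. \<not> {i, j, k} \<subseteq> set Q)"
proof -
  \<comment> \<open>Five candidates suffice: 16 to 19 lie in one member of \<open>quads\<close>
    only, so one of them works unless \<open>i\<close> and \<open>j\<close> are both among them, and
    then 15 works.\<close>
  have *: "list_all (\<lambda>i. list_all (\<lambda>j. list_ex (\<lambda>k. k \<noteq> i \<and> k \<noteq> j \<and>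
      list_all (\<lambda>Q. i \<notin> set Q \<or> j \<notin> set Q \<or> k \<notin> set Q) quads) [15..<20]) [0..<i]) [0..<28]"
    by code_simp
  show ?thesis
  proof (intro allI impI)
    fix i j :: nat assume "i < 28" "j < i"
    then have "i \<in> set [0..<28]" "j \<in> set [0..<i]" by simp_all
    with * obtain k where k: "k \<in> set [15..<20]" "k \<noteq> i" "k \<noteq> j"
      "\<forall>Q\<in>set quads. i \<notin> set Q \<or> j \<notin> set Q \<or> k \<notin> set Q"
      unfolding list_all_iff list_ex_iff by blast
    from k(1) have "k < 28" by auto
    with k(2-) show "\<exists>k<28. k \<noteq> i \<and> k \<noteq> j \<and> (\<forall>Q\<in>set quads. \<not> {i, j, k} \<subseteq> set Q)" by blast
  qed
qed

text \<open>If two of the lines coincided, any point shared with a third line would make all three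
  concurrent, also for a third line chosen outside their quadruples.\<close>

lemma inj_kk_line: "inj_on kk_line {..<28}"
proof (rule linorder_inj_onI)
  fix j i :: nat assume ij: "j < i" "j \<in> {..<28}" "i \<in> {..<28}"
  show "kk_line j \<noteq> kk_line i"
  proof
    assume eq: "kk_line j = kk_line i"
    obtain k where k: "k < 28" "k \<noteq> i" "k \<noteq> j" "\<forall>Q\<in>set quads. \<not> {i, j, k} \<subseteq> set Q"
      using not_in_quad[rule_format, of i j] ij by blast
    obtain P where "P \<in> proj_points" "P \<subseteq> kk_line i" "P \<subseteq> kk_line k"
      using proj_lines_common_point kk_line_proj_line k(1) ij by blast
    then show False using concurrent_imp_quad[of i j k P] eq k ij by auto
  qed
qed auto

lemma quads_distinct: "\<forall>Q\<in>set quads. \<forall>Q'\<in>set quads. \<forall>i\<in>set Q. \<forall>j\<in>set Q. i \<noteq> j \<longrightarrow> i \<in> set Q' \<longrightarrow> j \<in> set Q' \<longrightarrow> Q = Q'"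
  by code_simp

lemma quads_card: "\<forall>Q\<in>set quads. set Q \<subseteq> {..<28} \<and> card (set Q) = 4"
  by (simp add: quads_def)

lemma quads_point:
  "\<forall>Q\<in>set quads. \<exists>P\<in>proj_points. \<forall>i\<in>set Q. P \<subseteq> kk_line i"
proof -
  \<comment> \<open>The final \<open>True\<close> is what unfolding the bounded quantifier over an
    explicit list leaves for the empty rest.\<close>
  have wit: "\<exists>P\<in>proj_points. P \<subseteq> kk_line i \<and> P \<subseteq> kk_line j \<and> P \<subseteq> kk_line k \<and> P \<subseteq> kk_line l \<and> True"
    if "v \<noteq> 0" "v \<in> kk_line i" "v \<in> kk_line j" "v \<in> kk_line k" "v \<in> kk_line l"
      "i < 28" "j < 28" "k < 28" "l < 28" for v i j k l
  proof -
    have "vec.span {v} \<subseteq> kk_line m" if "m < 28" "v \<in> kk_line m" for m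
      using that kk_line_proj_line[of m]
      by (intro vec.span_minimal) (simp_all add: proj_lines_def)
    then show ?thesis using span_point[OF that(1)] that by blast
  qed
  have neq: "vector [x, y, z] \<noteq> (0 :: complex ^ 3) \<longleftrightarrow> x \<noteq> 0 \<or> y \<noteq> 0 \<or> z \<noteq> 0" for x y z
    by (simp add: vec_eq_iff forall_3)
  show ?thesis
    unfolding quads_def list.set ball_simps
  proof (intro conjI TrueI, goal_cases)
    case 1
    show ?case by (rule wit[of "vector [1, 0, 1]"]) (simp_all add: neq kk_line_def kk_coeffs_def)
  next
    case 2
    show ?case by (rule wit[of "vector [0, 1, 1]"]) (simp_all add: neq kk_line_def kk_coeffs_def)
  next
    case 3
    show ?case by (rule wit[of "vector [1, -1, 0]"]) (simp_all add: neq kk_line_def kk_coeffs_def)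
  next
    case 4
    show ?case by (rule wit[of "vector [1, 1, 0]"]) (simp_all add: neq kk_line_def kk_coeffs_def)
  next
    case 5
    show ?case by (rule wit[of "vector [0, 1, -1]"]) (simp_all add: neq kk_line_def kk_coeffs_def)
  next
    case 6
    show ?case by (rule wit[of "vector [1, 0, -1]"]) (simp_all add: neq kk_line_def kk_coeffs_def)
  next
    case 7
    show ?case by (rule wit[of "vector [1, 0, 0]"]) (simp_all add: neq kk_line_def kk_coeffs_def)
  next
    case 8
    show ?case by (rule wit[of "vector [0, 1, 0]"]) (simp_all add: neq kk_line_def kk_coeffs_def)
  next
    case 9
    show ?case by (rule wit[of "vector [0, 0, 1]"]) (simp_all add: neq kk_line_def kk_coeffs_def)
  qed
qed

lemma quads_card_9: "card (set ` set quads) = 9"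
proof -
  have "distinct (map set quads)" "length (map set quads) = 9" by code_simp+
  then have "card (set (map set quads)) = 9" by (simp only: distinct_card)
  then show ?thesis by simp
qed

lemma pairs_card:
  "card {(i, j). i < j \<and> j < 28 \<and> (\<forall>Q\<in>set ` set quads. \<not> {i, j} \<subseteq> Q)} = 324"
proof -
  let ?ps = "filter (\<lambda>(i, j). i < j \<and> \<not> (\<exists>Q\<in>set quads. i \<in> set Q \<and> j \<in> set Q)) (List.product [0..<28] [0..<28])"
  have "length ?ps = 324" by code_simp
  then have "card (set ?ps) = 324" by (subst distinct_card) (simp_all add: distinct_product)
  moreover have "set ?ps = {(i, j). i < j \<and> j < 28 \<and> (\<forall>Q\<in>set ` set quads. \<not> {i, j} \<subseteq> Q)}"
    by auto
  ultimately show ?thesis by simp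
qed

theorem proposition3p3:
  shows "card (bitangents komiya_kuribayashi) = 28 \<and>
    card (double_points (bitangents komiya_kuribayashi)) = 324 \<and>
    card (quadruple_points (bitangents komiya_kuribayashi)) = 9 \<and>
    intersection_points (bitangents komiya_kuribayashi) =
      double_points (bitangents komiya_kuribayashi) \<union>
      quadruple_points (bitangents komiya_kuribayashi)"
proof -
  have triples: "\<exists>Q\<in>set ` set quads. {i, j, k} \<subseteq> Q"
    if "i < 28" "j < 28" "k < 28" "i \<noteq> j" "i \<noteq> k" "j \<noteq> k"
      "P \<in> proj_points" "P \<subseteq> kk_line i" "P \<subseteq> kk_line j" "P \<subseteq> kk_line k" for i j k P
    using concurrent_imp_quad[OF that] by blast
  have card4: "Q \<subseteq> {..<28} \<and> card Q = 4" if "Q \<in> set ` set quads" for Q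
    using quads_card that by blast
  have point: "\<exists>P\<in>proj_points. \<forall>i\<in>Q. P \<subseteq> kk_line i" if "Q \<in> set ` set quads" for Q
    using quads_point that by blast
  have inter: "Q = Q'" if "Q \<in> set ` set quads" "Q' \<in> set ` set quads" "{i, j} \<subseteq> Q \<inter> Q'" "i \<noteq> j" for Q Q' i j
  proof -
    from that obtain q q' where "Q = set q" "Q' = set q'" "q \<in> set quads" "q' \<in> set quads" by blast
    with that quads_distinct[rule_format, of q q' i j] show ?thesis by simp
  qed
  note counts = arrangement_counts[of 28 kk_line "set ` set quads", OF kk_line_proj_line inj_kk_line triples card4 point inter]
  have "card (bitangents komiya_kuribayashi) = 28"
    unfolding bitangents_kk_line using card_image[OF inj_kk_line] by simp
  moreover have "card (double_points (bitangents komiya_kuribayashi)) = 324"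
    unfolding bitangents_kk_line pairs_card[symmetric] by (rule counts(2))
  moreover have "card (quadruple_points (bitangents komiya_kuribayashi)) = 9"
    unfolding bitangents_kk_line quads_card_9[symmetric] by (rule counts(1))
  moreover have "intersection_points (bitangents komiya_kuribayashi) =
      double_points (bitangents komiya_kuribayashi) \<union> quadruple_points (bitangents komiya_kuribayashi)"
    unfolding bitangents_kk_line by (rule counts(3))
  ultimately show ?thesis by blast
qed

end
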